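(* For each integer $k\ge 0$ let $$c_k:=\sum_{j=0}^k (-1)^j \binom{k}{j}\frac{1}{\zeta(2j+2)},$$ where $\zeta$ is the Riemann zeta function. Let $\alpha$ be a real number. Then $\zeta(s)\neq 0$ for all $s$ in the half-plane $\Re(s)>2(1-\alpha)$ if and only if, for every $\epsilon>0$, $$c_k\ll k^{-\alpha+\epsilon}.$$
   Context: The notation $c_k\ll k^{-\alpha+\epsilon}$ means that there is a constant $C>0$ (which may depend on $\alpha$ and $\epsilon$) such that $|c_k|\le C\, k^{-\alpha+\epsilon}$ for all integers $k\ge 1$. Here $\zeta$ denotes the meromorphic continuation of the zeta function to $\mathbb{C}$; its pole $s=1$ is not regarded as a zero. *)

theory Defs
  imports "HOL-Complex_Analysis.Complex_Analysis"
begin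

section \<open>The Riemann zeta function\<close>

text \<open>
  The zeta function is the meromorphic continuation to the whole complex plane of the Dirichlet
  series that converges for \<open>Re s > 1\<close>. Because of the conventions built into
  \<^const>\<open>nicely_meromorphic_on\<close> there are no removable singularities, and the value at a pole
  is 0; hence \<open>zeta 1 = 0\<close>, although 1 is a pole and not a zero. Existence and uniqueness of
  the continuation are proved below.
\<close>

definition zeta :: "complex \<Rightarrow> complex" where
  "zeta = (THE f. f nicely_meromorphic_on UNIV \<and>
                  (\<forall>s. Re s > 1 \<longrightarrow> (\<lambda>n. 1 / of_nat (Suc n) powr s) sums f s))"

definition zeta_coeff :: "nat \<Rightarrow> complex" where
  "zeta_coeff k = (\<Sum>j=0..k. (-1) ^ j * of_nat (k choose j) * (1 / zeta (of_nat (2 * j + 2))))"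


section \<open>Existence and uniqueness of the continuation\<close>

lemma zeta_summable:
  assumes "Re s > 1"
  shows "summable (\<lambda>n. 1 / of_nat (Suc n) powr s :: complex)"
proof -
  have "summable (\<lambda>n. real n powr (- Re s))"
    using assms by (subst summable_real_powr_iff) auto
  hence S: "summable (\<lambda>n. real (Suc n) powr (- Re s))"
    by (subst summable_Suc_iff)
  have N: "norm (1 / of_nat (Suc n) powr s :: complex) = real (Suc n) powr (- Re s)" for n
    unfolding norm_divide norm_one powr_minus
    by (subst norm_powr_real_powr) (auto simp: divide_inverse)
  show ?thesis
    by (rule summable_norm_cancel) (use S N in presburger)
qed

definition dser :: "complex \<Rightarrow> complex" where
  "dser s = (\<Sum>n. 1 / of_nat (Suc n) powr s)"

lemma dser_sums:
  "Re s > 1 \<Longrightarrow> (\<lambda>n. 1 / of_nat (Suc n) powr s) sums dser s"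
  unfolding dser_def using zeta_summable by blast

text \<open>
  The continuation is obtained strip by strip, by expanding \<open>(N + 1) powr (1 - s)\<close> at
  \<open>N\<close> up to order \<open>m\<close> and summing over \<open>N\<close>. The falling factorials below are the
  numerators of the Taylor coefficients, and \<open>taylor_rem\<close> is the (negated) remainder.
\<close>

definition ffac :: "nat \<Rightarrow> complex \<Rightarrow> complex" where
  "ffac i s = (\<Prod>k<i. 1 - s - of_nat k)"

definition taylor_rem :: "nat \<Rightarrow> complex \<Rightarrow> nat \<Rightarrow> complex" where
  "taylor_rem m s n = (\<Sum>i\<le>m. ffac i s / fact i * of_nat (Suc n) powr (1 - s - of_nat i))
                   - of_nat (Suc (Suc n)) powr (1 - s)"

lemma taylor_rem_bound:
  assumes "Re s + real m \<ge> 0"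
  shows "norm (taylor_rem m s n) \<le> norm (ffac (Suc m) s) * real (Suc n) powr (- Re s - real m)"
proof -
  define N where "N = real (Suc n)"
  define f where "f = (\<lambda>i z. ffac i s * z powr (1 - s - of_nat i))"
  let ?S = "closed_segment (complex_of_real N) (of_real (N + 1))"
  have N: "N > 0" by (simp add: N_def)
  have S: "\<exists>x. z = of_real x \<and> N \<le> x" if "z \<in> ?S" for z
    using that by (subst (asm) closed_segment_of_real) (auto simp: closed_segment_eq_real_ivl)
  have "norm (f 0 (of_real (N+1)) - (\<Sum>i\<le>m. f i (of_real N) * (of_real (N+1) - of_real N) ^ i / fact i))
      \<le> (norm (ffac (Suc m) s) * N powr (- Re s - real m)) * norm (complex_of_real (N+1) - of_real N) ^ Suc m / fact m"
  proof (rule complex_Taylor[where S = ?S])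
    fix i z assume "z \<in> ?S"
    then obtain x where x: "z = of_real x" "N \<le> x" using S by blast
    have "((\<lambda>z. z powr (1 - s - of_nat i)) has_field_derivative
            ((1 - s - of_nat i) * z powr (1 - s - of_nat i - 1))) (at z within ?S)"
      by (rule has_field_derivative_at_within, rule has_field_derivative_powr)
         (use x N in \<open>auto simp: complex_nonpos_Reals_iff\<close>)
    from DERIV_cmult[OF this, of "ffac i s"]
    show "(f i has_field_derivative f (Suc i) z) (at z within ?S)"
      by (simp add: f_def ffac_def algebra_simps)
  next
    fix z assume "z \<in> ?S"
    then obtain x where x: "z = of_real x" "N \<le> x" using S by blast
    have "norm (z powr (1 - s - of_nat (Suc m))) = x powr (- Re s - real m)"
      using x N by (subst norm_powr_real_powr) auto
    also have "\<dots> \<le> N powr (- Re s - real m)"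
      using x N assms by (intro powr_mono2') auto
    finally show "norm (f (Suc m) z) \<le> norm (ffac (Suc m) s) * N powr (- Re s - real m)"
      unfolding f_def norm_mult by (intro mult_left_mono) auto
  qed auto
  also have "\<dots> = (norm (ffac (Suc m) s) * N powr (- Re s - real m)) / fact m"
    by simp
  also have "\<dots> \<le> norm (ffac (Suc m) s) * N powr (- Re s - real m)"
    using mult_left_mono[OF fact_ge_1[of m, where 'a = real], of "norm (ffac (Suc m) s) * N powr (- Re s - real m)"]
    by (simp add: divide_le_eq)
  also have "f 0 (of_real (N+1)) - (\<Sum>i\<le>m. f i (of_real N) * (of_real (N+1) - of_real N) ^ i / fact i)
     = - taylor_rem m s n"
    by (simp add: taylor_rem_def f_def N_def ffac_def add_ac)
  finally show ?thesis by (simp add: N_def)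
qed

lemma holomorphic_taylor_rem: "(\<lambda>s. taylor_rem m s n) holomorphic_on A"
  unfolding taylor_rem_def ffac_def by (intro holomorphic_intros) (auto simp del: of_nat_Suc)

lemma taylor_rem_suminf:
  fixes m :: nat
  defines "A \<equiv> {s. Re s > 1 - real m}"
  shows "(\<lambda>s. \<Sum>n. taylor_rem m s n) holomorphic_on A"
    and "s \<in> A \<Longrightarrow> summable (taylor_rem m s)"
proof -
  have opn: "open A" unfolding A_def by (rule open_halfspace_Re_gt)
  have ul: "\<exists>d>0. cball z d \<subseteq> A \<and>
       uniform_limit (cball z d) (\<lambda>N s. \<Sum>n<N. taylor_rem m s n) (\<lambda>s. \<Sum>n. taylor_rem m s n) sequentially
       \<and> (\<forall>s\<in>cball z d. summable (taylor_rem m s))"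
    if z: "z \<in> A" for z
  proof -
    define d where "d = (Re z - (1 - real m)) / 2"
    define a where "a = Re z - d"
    have d: "d > 0" using z by (simp add: d_def A_def)
    have a: "a > 1 - real m" using d by (simp add: a_def d_def field_simps)
    have Re: "Re s \<ge> a" if "s \<in> cball z d" for s
      using that abs_Re_le_cmod[of "z - s"] by (simp add: a_def dist_norm)
    have "compact ((\<lambda>s. ffac (Suc m) s) ` cball z d)"
      unfolding ffac_def by (intro compact_continuous_image continuous_intros) auto
    then obtain K where K: "\<And>s. s \<in> cball z d \<Longrightarrow> norm (ffac (Suc m) s) \<le> K"
      by (meson bounded_iff compact_imp_bounded imageI)
    have bd: "norm (taylor_rem m s n) \<le> K * real (Suc n) powr (- a - real m)"
      if s: "s \<in> cball z d" for s n
    proof -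
      have "norm (taylor_rem m s n) \<le> norm (ffac (Suc m) s) * real (Suc n) powr (- Re s - real m)"
        by (rule taylor_rem_bound) (use Re[OF s] a in auto)
      also have "\<dots> \<le> K * real (Suc n) powr (- a - real m)"
      proof (rule mult_mono)
        show "0 \<le> K" using K[OF s] norm_ge_zero by (rule order_trans[rotated])
        show "real (Suc n) powr (- Re s - real m) \<le> real (Suc n) powr (- a - real m)"
          using Re[OF s] by (intro powr_mono) auto
      qed (use K[OF s] in auto)
      finally show ?thesis .
    qed
    have "summable (\<lambda>n. real n powr (- a - real m))"
      using a by (subst summable_real_powr_iff) auto
    hence "summable (\<lambda>n. real (Suc n) powr (- a - real m))"
      by (subst summable_Suc_iff)
    hence sm: "summable (\<lambda>n. K * real (Suc n) powr (- a - real m))"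
      by (rule summable_mult)
    have "uniform_limit (cball z d) (\<lambda>N s. \<Sum>n<N. taylor_rem m s n) (\<lambda>s. \<Sum>n. taylor_rem m s n) sequentially"
      by (rule Weierstrass_m_test[OF bd sm])
    moreover have "summable (taylor_rem m s)" if "s \<in> cball z d" for s
      by (rule summable_comparison_test'[OF sm, of 0]) (use bd that in auto)
    moreover have "cball z d \<subseteq> A"
      using Re a by (force simp: A_def)
    ultimately show ?thesis using d by blast
  qed
  show "(\<lambda>s. \<Sum>n. taylor_rem m s n) holomorphic_on A"
  proof (rule holomorphic_uniform_sequence[OF opn, where f = "\<lambda>N s. \<Sum>n<N. taylor_rem m s n"])
    fix N :: nat
    show "(\<lambda>s. \<Sum>n<N. taylor_rem m s n) holomorphic_on A"
      by (intro holomorphic_intros holomorphic_taylor_rem)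
  qed (use ul in blast)
  show "summable (taylor_rem m s)" if "s \<in> A"
    using ul[OF that] by (meson centre_in_cball less_imp_le)
qed

lemma sum_taylor_rem:
  assumes s: "Re s > 1"
  shows "(\<Sum>n. taylor_rem m s n) =
           1 + (\<Sum>i=1..m. ffac i s / fact i * dser (s + of_nat i - 1))"
proof -
  let ?p = "\<lambda>n. of_nat (Suc n) powr (1 - s) :: complex"
  have "(\<lambda>n. real n powr (1 - Re s)) \<longlonglongrightarrow> 0"
    by (rule tendsto_neg_powr) (use s in \<open>auto intro: filterlim_real_sequentially\<close>)
  hence "(\<lambda>n. real (Suc n) powr (1 - Re s)) \<longlonglongrightarrow> 0"
    by (rule LIMSEQ_Suc)
  moreover have "norm (?p n) = real (Suc n) powr (1 - Re s)" for n
    by (subst norm_powr_real_powr) auto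
  ultimately have "?p \<longlonglongrightarrow> 0"
    by (intro tendsto_norm_zero_cancel[of ?p]) presburger
  from telescope_sums'[OF this]
  have tel: "(\<lambda>n. ?p n - ?p (Suc n)) sums 1" by simp
  have "(\<lambda>n. ffac i s / fact i * (1 / of_nat (Suc n) powr (s + of_nat i - 1)))
          sums (ffac i s / fact i * dser (s + of_nat i - 1))" if "i \<in> {1..m}" for i
    using that s by (intro sums_mult dser_sums) auto
  hence "(\<lambda>n. \<Sum>i=1..m. ffac i s / fact i * (1 / of_nat (Suc n) powr (s + of_nat i - 1)))
     sums (\<Sum>i=1..m. ffac i s / fact i * dser (s + of_nat i - 1))"
    by (rule sums_sum)
  from sums_add[OF tel this] have "(\<lambda>n. ?p n - ?p (Suc n) +
          (\<Sum>i=1..m. ffac i s / fact i * (1 / of_nat (Suc n) powr (s + of_nat i - 1))))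
     sums (1 + (\<Sum>i=1..m. ffac i s / fact i * dser (s + of_nat i - 1)))" .
  also have "(\<lambda>n. ?p n - ?p (Suc n) +
          (\<Sum>i=1..m. ffac i s / fact i * (1 / of_nat (Suc n) powr (s + of_nat i - 1)))) = taylor_rem m s"
  proof
    fix n
    have "1 / of_nat (Suc n) powr (s + of_nat i - 1) = (of_nat (Suc n) powr (1 - s - of_nat i) :: complex)" for i
      using powr_minus[of "of_nat (Suc n) :: complex" "s + of_nat i - 1"]
      by (simp add: divide_inverse algebra_simps del: of_nat_Suc)
    moreover have "{..m} = insert 0 {1..m}" by auto
    ultimately show "?p n - ?p (Suc n) +
          (\<Sum>i=1..m. ffac i s / fact i * (1 / of_nat (Suc n) powr (s + of_nat i - 1))) = taylor_rem m s n"
      unfolding taylor_rem_def by (simp add: ffac_def del: of_nat_Suc)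
  qed
  finally show ?thesis by (simp add: sums_iff)
qed

lemma ffac_Suc: "ffac (Suc i) s = - ffac i s * (s + of_nat i - 1)"
  by (simp add: ffac_def algebra_simps)

lemma ffac_one: "i > 0 \<Longrightarrow> ffac i 1 = 0"
  unfolding ffac_def by (rule prod_zero) auto

lemma continuation_halfplane:
  "\<exists>F. F holomorphic_on {s. Re s > 1 - real m} \<and> (\<forall>s. Re s > 1 \<longrightarrow> F s = (s - 1) * dser s)
       \<and> (m > 0 \<longrightarrow> F 1 = 1)"
proof (induction m)
  case 0
  have "(\<lambda>s. 1 - (\<Sum>n. taylor_rem 1 s n)) holomorphic_on {s. Re s > 1}"
    by (intro holomorphic_intros holomorphic_on_subset[OF taylor_rem_suminf(1)[of 1]]) auto
  moreover have "1 - (\<Sum>n. taylor_rem 1 s n) = (s - 1) * dser s" if "Re s > 1" for s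
    by (subst sum_taylor_rem[OF that]) (simp add: ffac_def algebra_simps)
  ultimately show ?case by auto
next
  case (Suc m)
  then obtain F where F: "F holomorphic_on {s. Re s > 1 - real m}"
    "\<And>s. Re s > 1 \<Longrightarrow> F s = (s - 1) * dser s" by blast
  define G where "G = (\<lambda>s. 1 - (\<Sum>n. taylor_rem (Suc m) s n)
      - (\<Sum>i=1..m. ffac i s / fact (Suc i) * F (s + of_nat i)))"
  have "G holomorphic_on {s. Re s > 1 - real (Suc m)}"
    unfolding G_def
  proof (intro holomorphic_intros taylor_rem_suminf(1))
    fix i assume i: "i \<in> {1..m}"
    show "(\<lambda>s. F (s + of_nat i)) holomorphic_on {s. Re s > 1 - real (Suc m)}"
      by (rule holomorphic_on_compose_gen[of "\<lambda>s. s + of_nat i", unfolded o_def, OF _ F(1)])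
         (use i in \<open>auto intro!: holomorphic_intros\<close>)
  qed (auto simp: ffac_def simp del: fact_Suc intro!: holomorphic_intros)
  moreover have "G s = (s - 1) * dser s" if s: "Re s > 1" for s
  proof -
    have "(\<Sum>i=1..Suc m. ffac i s / fact i * dser (s + of_nat i - 1)) =
          (\<Sum>i\<in>insert 0 {1..m}. ffac (Suc i) s / fact (Suc i) * dser (s + of_nat i))"
      by (rule sum.reindex_bij_witness[of _ Suc "\<lambda>i. i - 1"]) (auto simp: add_diff_eq Suc_le_eq)
    also have "\<dots> = - (s - 1) * dser s + (\<Sum>i=1..m. ffac (Suc i) s / fact (Suc i) * dser (s + of_nat i))"
      by (simp add: ffac_def)
    also have "(\<Sum>i=1..m. ffac (Suc i) s / fact (Suc i) * dser (s + of_nat i)) =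
        (\<Sum>i=1..m. - (ffac i s / fact (Suc i) * F (s + of_nat i)))"
    proof (rule sum.cong[OF refl])
      fix i assume "i \<in> {1..m}"
      hence "F (s + of_nat i) = (s + of_nat i - 1) * dser (s + of_nat i)"
        using s by (intro F(2)) auto
      thus "ffac (Suc i) s / fact (Suc i) * dser (s + of_nat i)
          = - (ffac i s / fact (Suc i) * F (s + of_nat i))"
        by (simp add: ffac_Suc del: fact_Suc)
    qed
    finally show ?thesis
      unfolding G_def sum_taylor_rem[OF s] by (simp add: sum_negf algebra_simps del: fact_Suc)
  qed
  moreover have "G 1 = 1"
  proof -
    have "taylor_rem (Suc m) 1 = (\<lambda>_. 0)"
    proof
      fix n
      have "(\<Sum>i\<le>Suc m. ffac i 1 / fact i * of_nat (Suc n) powr (1 - 1 - of_nat i)) =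
            (\<Sum>i\<in>{0}. ffac i 1 / fact i * of_nat (Suc n) powr (1 - 1 - of_nat i) :: complex)"
        by (rule sum.mono_neutral_right) (auto simp: ffac_one simp del: fact_Suc)
      also have "\<dots> = 1" by (simp add: ffac_def del: of_nat_Suc)
      finally show "taylor_rem (Suc m) 1 n = 0"
        unfolding taylor_rem_def by (simp del: of_nat_Suc sum.atMost_Suc)
    qed
    moreover have "(\<Sum>i=1..m. ffac i 1 / fact (Suc i) * F (1 + of_nat i)) = 0"
      by (rule sum.neutral) (auto simp: ffac_one)
    ultimately show ?thesis by (simp add: G_def)
  qed
  ultimately show ?case by blast
qed

lemma continuation_entire:
  obtains F where "F holomorphic_on UNIV" "\<And>s. Re s > 1 \<Longrightarrow> F s = (s - 1) * dser s" "F 1 = 1"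
proof -
  define H where "H = (\<lambda>m. {s. Re s > 1 - real m})"
  obtain F where F: "\<And>m. F m holomorphic_on H m"
      "\<And>m s. Re s > 1 \<Longrightarrow> F m s = (s - 1) * dser s" "\<And>m. m > 0 \<Longrightarrow> F m 1 = 1"
  proof -
    from choice[OF allI[OF continuation_halfplane]] obtain F where
      F: "\<forall>m. F m holomorphic_on {s. Re s > 1 - real m} \<and>
             (\<forall>s. Re s > 1 \<longrightarrow> F m s = (s - 1) * dser s) \<and> (m > 0 \<longrightarrow> F m 1 = 1)" ..
    show ?thesis
      by (rule that[of F]) (use F in \<open>auto simp: H_def\<close>)
  qed
  have opn: "open (H m)" for m unfolding H_def by (rule open_halfspace_Re_gt)
  have mono: "F m s = F m' s" if "m \<le> m'" "s \<in> H m" for m m' s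
  proof (rule analytic_continuation_open[where s = "H 0" and s' = "H m" and f = "F m" and g = "F m'"])
    show "open (H 0)" "open (H m)" by (rule opn)+
    show "connected (H m)"
      unfolding H_def by (intro convex_connected convex_halfspace_Re_gt)
    show "F m' holomorphic_on H m"
      by (rule holomorphic_on_subset[OF F(1)]) (use that in \<open>auto simp: H_def\<close>)
    have "2 \<in> H 0" by (simp add: H_def)
    thus "H 0 \<noteq> {}" by blast
    show "H 0 \<subseteq> H m" by (auto simp: H_def)
    show "F m z = F m' z" if "z \<in> H 0" for z
      using that F(2) by (simp add: H_def)
  qed (use that(2) F(1) in blast)+
  have uni: "F m s = F m' s" if "s \<in> H m" "s \<in> H m'" for m m' s
    by (cases m m' rule: le_cases)
       (use mono[of m m' s, OF _ that(1)] mono[of m' m s, OF _ that(2), symmetric] in blast)+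
  have ex: "\<exists>m. s \<in> H m" for s
  proof -
    obtain m where "real m > 1 - Re s" using reals_Archimedean2 by blast
    thus ?thesis by (auto simp: H_def intro!: exI[of _ m])
  qed
  define E where "E = (\<lambda>s. F (SOME m. s \<in> H m) s)"
  have E: "E s = F m s" if "s \<in> H m" for s m
    unfolding E_def by (rule uni[OF someI_ex[OF ex] that])
  show ?thesis
  proof
    have "E holomorphic_on H m" for m
      by (rule holomorphic_transform[OF F(1)]) (use E in auto)
    hence "E field_differentiable at s" for s
      using ex[of s] opn holomorphic_on_imp_differentiable_at by blast
    thus "E holomorphic_on UNIV"
      by (simp add: holomorphic_on_def)
    show "E s = (s - 1) * dser s" if "Re s > 1" for s
      using E[of s 0] F(2)[of s 0] that by (simp add: H_def)
    show "E 1 = 1"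
      using E[of 1 1] F(3)[of 1] by (simp add: H_def)
  qed
qed

lemma nicely_meromorphic_unique:
  assumes f: "f nicely_meromorphic_on UNIV" and g: "g nicely_meromorphic_on UNIV"
      and eq: "\<And>s. Re s > 1 \<Longrightarrow> f s = g s"
  shows "f = g"
proof
  fix z
  define h where "h = remove_sings (\<lambda>s. f s - g s)"
  have m: "(\<lambda>s. f s - g s) meromorphic_on UNIV"
    using f g by (auto simp: nicely_meromorphic_on_def intro!: meromorphic_intros)
  have nm: "h nicely_meromorphic_on UNIV"
    unfolding h_def by (rule remove_sings_nicely_meromorphic[OF m])
  have ev: "eventually (\<lambda>s. h s = f s - g s) (at w)" for w
    unfolding h_def using eventually_remove_sings_eq[OF m]
    by (simp add: eventually_cosparse_open_eq)
  have "eventually (\<lambda>s. s \<in> {s. Re s > 1}) (at (2::complex))"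
    by (intro eventually_at_in_open' open_halfspace_Re_gt) auto
  hence "eventually (\<lambda>s. h s = 0) (at 2)"
    using ev[of 2] by eventually_elim (use eq in auto)
  hence "frequently (\<lambda>s. h s = 0) (at 2)"
    by (intro eventually_frequently) auto
  hence "h w = 0" for w
    by (rule frequently_eq_meromorphic_imp_constant[OF _ nm]) auto
  hence evz: "eventually (\<lambda>s. f s = g s) (at z)"
    using ev[of z] by auto
  have pole: "is_pole f z \<longleftrightarrow> is_pole g z"
    by (rule is_pole_cong[OF evz refl])
  show "f z = g z"
  proof (cases "is_pole f z")
    case True
    have "h' z = 0" if "is_pole h' z" "h' nicely_meromorphic_on UNIV" for h'
    proof -
      have "\<not> h' \<midarrow>z\<rightarrow> h' z"
        using that(1) not_tendsto_and_filterlim_at_infinity[of "at z" h' "h' z"]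
        by (auto simp: is_pole_def)
      thus ?thesis
        using that(2) unfolding nicely_meromorphic_on_def by blast
    qed
    from this[OF _ f] this[OF _ g] show ?thesis
      using True pole by simp
  next
    case False
    hence "f \<midarrow>z\<rightarrow> f z" "g \<midarrow>z\<rightarrow> g z"
      using pole f g by (auto simp: nicely_meromorphic_on_def)
    moreover have "f \<midarrow>z\<rightarrow> g z \<longleftrightarrow> g \<midarrow>z\<rightarrow> g z"
      by (rule tendsto_cong[OF evz])
    ultimately show ?thesis
      using LIM_unique by blast
  qed
qed

lemma zeta_eq_quotient:
  assumes F: "F holomorphic_on UNIV" "\<And>s. Re s > 1 \<Longrightarrow> F s = (s - 1) * dser s" "F 1 = 1"
  shows "zeta = (\<lambda>s. F s / (s - 1))" "is_pole (\<lambda>s. F s / (s - 1)) 1"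
        "(\<lambda>s. F s / (s - 1)) nicely_meromorphic_on UNIV"
proof -
  let ?g = "\<lambda>s. F s / (s - 1)"
  have an: "F analytic_on A" for A
    using F(1) analytic_on_holomorphic by blast
  have cont: "isCont F z" for z
    using an analytic_at_imp_isCont by blast
  show pole: "is_pole ?g 1"
    by (rule is_pole_divide) (use F(3) cont in \<open>auto simp: filterlim_at eventually_at_filter
        intro!: tendsto_eq_intros\<close>)
  have "?g meromorphic_on UNIV"
    by (intro meromorphic_intros analytic_on_imp_meromorphic_on an)
  moreover have "?g \<midarrow>z\<rightarrow> ?g z" if "z \<noteq> 1" for z
    using that cont[of z] by (intro tendsto_intros) (auto simp: isCont_def)
  ultimately show nm: "?g nicely_meromorphic_on UNIV"
    unfolding nicely_meromorphic_on_def
  proof (intro conjI ballI)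
    fix z :: complex
    assume "\<And>z. z \<noteq> 1 \<Longrightarrow> ?g \<midarrow>z\<rightarrow> ?g z"
    thus "is_pole ?g z \<and> ?g z = 0 \<or> ?g \<midarrow>z\<rightarrow> ?g z"
      using pole by (cases "z = 1") auto
  qed
  have sums: "(\<lambda>n. 1 / of_nat (Suc n) powr s) sums ?g s" if "Re s > 1" for s
  proof -
    have "s \<noteq> 1" using that by auto
    thus ?thesis using dser_sums[OF that] F(2)[OF that] by simp
  qed
  show "zeta = ?g"
    unfolding zeta_def
  proof (rule the_equality)
    fix f assume f: "f nicely_meromorphic_on UNIV \<and>
       (\<forall>s. Re s > 1 \<longrightarrow> (\<lambda>n. 1 / of_nat (Suc n) powr s) sums f s)"
    show "f = ?g"
      by (rule nicely_meromorphic_unique) (use f nm sums sums_unique2 in blast)+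
  qed (use nm sums in blast)
qed

theorem zeta_nicely_meromorphic: "zeta nicely_meromorphic_on UNIV"
proof -
  obtain F where F: "F holomorphic_on UNIV" "\<And>s. Re s > 1 \<Longrightarrow> F s = (s - 1) * dser s" "F 1 = 1"
    using continuation_entire by blast
  show ?thesis
    using zeta_eq_quotient(1,3)[OF F] by simp
qed

theorem zeta_sums:
  assumes "Re s > 1"
  shows "(\<lambda>n. 1 / of_nat (Suc n) powr s) sums zeta s"
proof -
  obtain F where F: "F holomorphic_on UNIV" "\<And>s. Re s > 1 \<Longrightarrow> F s = (s - 1) * dser s" "F 1 = 1"
    using continuation_entire by blast
  have "s \<noteq> 1" using assms by auto
  thus ?thesis
    using dser_sums[OF assms] by (simp add: zeta_eq_quotient(1)[OF F] F(2)[OF assms])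
qed

theorem is_pole_zeta: "is_pole zeta 1"
proof -
  obtain F where F: "F holomorphic_on UNIV" "\<And>s. Re s > 1 \<Longrightarrow> F s = (s - 1) * dser s" "F 1 = 1"
    using continuation_entire by blast
  show ?thesis
    using zeta_eq_quotient(1,2)[OF F] by simp
qed

theorem holomorphic_zeta: "zeta holomorphic_on - {1}"
proof -
  obtain F where F: "F holomorphic_on UNIV" "\<And>s. Re s > 1 \<Longrightarrow> F s = (s - 1) * dser s" "F 1 = 1"
    using continuation_entire by blast
  have "(\<lambda>s. F s / (s - 1)) holomorphic_on - {1}"
    by (intro holomorphic_intros holomorphic_on_subset[OF F(1)]) auto
  thus ?thesis
    by (simp only: zeta_eq_quotient(1)[OF F])
qed

end

(* Put f z = 1 / zeta (2z + 2), so that zeta_coeff k is the alternating binomial sum of f 0, ..., f k.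
   By partial fractions and Cauchy's formula it is the integral of f against
   k! / (w (w - 1) ... (w - k)) over a circle that encloses 0, ..., k and meets the real axis on the
   left at -b. On that circle the kernel is at most of order k powr -b, with as much polynomial
   decay in w as desired, so the bound on the coefficients only needs polynomial growth of 1 / zeta
   in half-planes without zeros. This follows from polynomial growth of zeta by the
   Borel-Caratheodory argument, uniformly over discs of fixed radius.
   Conversely, the same circles bound the remainder of the Newton interpolation series
   sum zeta_coeff k * pochhammer (-z) k / k!, which therefore represents f on (0, 1). If the
   coefficients are small, the series converges locally uniformly on Re z > -alpha and continues
   1 / zeta analytically, so that zeta has no zeros there. *)
theory Submission
  imports Defs
begin

section \<open>Integrals over circles touching a vertical line\<close>

text \<open>Partial fractions of a function with simple poles at 0, -1, ..., -k. By Pascal's rule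
  the sum for \<open>Suc k\<close> at \<open>x\<close> is the sum for \<open>k\<close> at
  \<open>x\<close> minus the one at \<open>x + 1\<close>, and the right-hand sides obey the same
  recursion.\<close>

lemma sum_choose_div_eq_fact_div_pochhammer:
  fixes x :: "'a :: field_char_0"
  assumes "\<And>j. j \<le> k \<Longrightarrow> x + of_nat j \<noteq> 0"
  shows "(\<Sum>j\<le>k. (-1) ^ j * of_nat (k choose j) / (x + of_nat j)) = fact k / pochhammer x (Suc k)"
  using assms
proof (induction k arbitrary: x)
  case 0
  then show ?case by simp
next
  case (Suc k)
  have nz: "pochhammer x (Suc (Suc k)) \<noteq> 0" "pochhammer (x + 1) (Suc k) \<noteq> 0" "x \<noteq> 0"
    "pochhammer x (Suc k) \<noteq> 0"
    using Suc.prems Suc.prems[of 0] Suc.prems[of "Suc _"]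
    by (auto simp: pochhammer_prod add_ac simp del: add_eq_0_iff_both_eq_0)
  have "(\<Sum>j\<le>Suc k. (-1) ^ j * of_nat (Suc k choose j) / (x + of_nat j))
      = 1 / x + (\<Sum>j\<le>k. (-1) ^ Suc j * of_nat (k choose Suc j) / (x + of_nat (Suc j)))
         - (\<Sum>j\<le>k. (-1) ^ j * of_nat (k choose j) / (x + 1 + of_nat j))"
    by (subst sum.atMost_Suc_shift)
       (simp add: sum.distrib[symmetric] sum_subtractf[symmetric] algebra_simps add_divide_distrib diff_divide_distrib
         sum_negf)
  \<comment> \<open>The added last term, \<open>j = Suc k\<close>, carries the coefficient
    \<open>k choose Suc k = 0\<close>.\<close>
  also have "1 / x + (\<Sum>j\<le>k. (-1) ^ Suc j * of_nat (k choose Suc j) / (x + of_nat (Suc j)))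
       = (\<Sum>j\<le>Suc k. (-1) ^ j * of_nat (k choose j) / (x + of_nat j))"
    by (subst sum.atMost_Suc_shift) simp
  also have "\<dots> = (\<Sum>j\<le>k. (-1) ^ j * of_nat (k choose j) / (x + of_nat j))" by simp
  also have "\<dots> = fact k / pochhammer x (Suc k)"
    by (rule Suc.IH) (use Suc.prems in auto)
  also have "(\<Sum>j\<le>k. (-1) ^ j * of_nat (k choose j) / (x + 1 + of_nat j)) = fact k / pochhammer (x + 1) (Suc k)"
    by (rule Suc.IH) (use Suc.prems[of "Suc _"] in \<open>auto simp: add_ac\<close>)
  also have "fact k / pochhammer x (Suc k) = fact k * (x + of_nat (Suc k)) / pochhammer x (Suc (Suc k))"
    using nz by (simp add: pochhammer_Suc[of x "Suc k"])
  also have "fact k / pochhammer (x + 1) (Suc k) = fact k * x / pochhammer x (Suc (Suc k))"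
    using nz by (simp add: pochhammer_rec[of x "Suc k"])
  also have "fact k * (x + of_nat (Suc k)) / pochhammer x (Suc (Suc k)) - fact k * x / pochhammer x (Suc (Suc k))
     = fact (Suc k) / pochhammer x (Suc (Suc k))"
    by (simp add: diff_divide_distrib[symmetric] algebra_simps)
  finally show ?case .
qed

text \<open>On a circle of radius R + b about R, bounding 1/|w|^2 by its maximum 1/b^2 and
  multiplying by the length loses a factor of order R. The exact mean, obtained from Cauchy's
  formula at 0, times the radius stays bounded as R grows.\<close>

lemma has_integral_inverse_norm_sq_circlepath:
  assumes "0 \<le> R" "R < \<rho>"
  shows "((\<lambda>x. 1 / (norm (circlepath (of_real R) \<rho> x))\<^sup>2) has_integral 1 / (\<rho>\<^sup>2 - R\<^sup>2)) {0..1}"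
proof -
  let ?p = "circlepath (of_real R :: complex) \<rho>"
  \<comment> \<open>On the circle, \<open>R * (w - R) + \<rho>\<^sup>2 = (w - R) * cnj w\<close>, so that \<open>h w / w\<close> is a Poisson-type kernel.\<close>
  define h where "h = (\<lambda>w::complex. 1 / (of_real R * (w - of_real R) + of_real (\<rho>\<^sup>2)))"
  \<comment> \<open>For \<open>R > 0\<close> the pole of \<open>h\<close> is the mirror image of 0
    in the circle; its distance from the centre is \<rho>^2/R > \<rho>.\<close>
  have nz: "of_real R * (w - of_real R) + of_real (\<rho>\<^sup>2) \<noteq> 0" if "norm (w - of_real R) \<le> \<rho>" for w :: complex
  proof
    assume "of_real R * (w - of_real R) + of_real (\<rho>\<^sup>2) = 0"
    hence "of_real R * (w - of_real R) = - complex_of_real (\<rho>\<^sup>2)" by (simp add: add_eq_0_iff2)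
    hence "norm (of_real R * (w - of_real R)) = norm (- complex_of_real (\<rho>\<^sup>2))" by (rule arg_cong)
    hence "R * norm (w - of_real R) = \<rho>\<^sup>2" using assms by (simp add: norm_mult norm_power)
    moreover have "R * norm (w - of_real R) \<le> R * \<rho>" using that assms by (intro mult_left_mono)
    moreover have "R * \<rho> < \<rho>\<^sup>2" using assms by (simp add: power2_eq_square)
    ultimately show False by simp
  qed
  have "((\<lambda>u. h u / (u - 0)) has_contour_integral (2 * of_real pi * \<i> * h 0)) ?p"
    by (rule Cauchy_integral_circlepath_simple)
       (use assms nz in \<open>auto simp: h_def dist_norm norm_minus_commute intro!: holomorphic_intros\<close>)
  hence "((\<lambda>x. h (?p x) / ?p x * vector_derivative ?p (at x within {0..1})) has_integral
             2 * of_real pi * \<i> * h 0) {0..1}"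
    by (simp add: has_contour_integral_def)
  also have "?this \<longleftrightarrow> ((\<lambda>x. 2 * of_real pi * \<i> * of_real (1 / (norm (?p x))\<^sup>2)) has_integral
             2 * of_real pi * \<i> * h 0) {0..1}"
  proof (rule has_integral_cong)
    fix x :: real assume x: "x \<in> {0..1}"
    define e where "e = of_real \<rho> * exp (2 * of_real pi * \<i> * of_real x)"
    have p: "?p x = of_real R + e" by (simp add: circlepath e_def)
    have d: "vector_derivative ?p (at x within {0..1}) = 2 * pi * \<i> * e"
      using x by (subst vector_derivative_circlepath01) (auto simp: e_def)
    have ne: "norm e = \<rho>" using assms by (simp add: e_def norm_mult)
    hence e0: "e \<noteq> 0" using assms by auto
    have cc: "of_real (\<rho>\<^sup>2) = e * cnj e" using ne complex_norm_square[of e] by simp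
    have "h (?p x) = 1 / (e * cnj (?p x))"
      by (simp add: h_def p cc algebra_simps del: of_real_power)
    moreover have "complex_of_real ((norm (?p x))\<^sup>2) = ?p x * cnj (?p x)"
      by (rule complex_norm_square)
    ultimately show "h (?p x) / ?p x * vector_derivative ?p (at x within {0..1})
       = 2 * of_real pi * \<i> * of_real (1 / (norm (?p x))\<^sup>2)"
      using e0 by (simp add: d mult_ac del: of_real_power)
  qed
  finally have "((\<lambda>x. 2 * of_real pi * \<i> * of_real (1 / (norm (?p x))\<^sup>2)) has_integral
             2 * of_real pi * \<i> * h 0) {0..1}" .
  from has_integral_mult_right[OF this, of "1 / (2 * of_real pi * \<i>)"]
  have "((\<lambda>x. complex_of_real (1 / (norm (?p x))\<^sup>2)) has_integral h 0) {0..1}" by simp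
  from has_integral_Re[OF this] have "((\<lambda>x. 1 / (norm (?p x))\<^sup>2) has_integral Re (h 0)) {0..1}"
    by simp
  moreover have "h 0 = of_real (1 / (\<rho>\<^sup>2 - R\<^sup>2))" by (simp add: h_def power2_eq_square)
  ultimately show ?thesis by (metis Re_complex_of_real)
qed

lemma contour_integral_bound_circlepath_norm_sq:
  assumes I: "(g has_contour_integral I) (circlepath (of_real R) \<rho>)" and R: "0 \<le> R" "R < \<rho>"
      and g: "\<And>w. norm (w - of_real R) = \<rho> \<Longrightarrow> norm (g w) \<le> M / (norm w)\<^sup>2"
  shows "norm I \<le> 2 * pi * M * \<rho> / (\<rho>\<^sup>2 - R\<^sup>2)"
proof -
  let ?p = "circlepath (of_real R :: complex) \<rho>"
  let ?g = "\<lambda>x. g (?p x) * vector_derivative ?p (at x within {0..1})"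
  have G: "(?g has_integral I) {0..1}"
    using I by (simp add: has_contour_integral_def)
  have H: "((\<lambda>x. 2 * pi * M * \<rho> * (1 / (norm (?p x))\<^sup>2)) has_integral 2 * pi * M * \<rho> * (1 / (\<rho>\<^sup>2 - R\<^sup>2))) {0..1}"
    by (rule has_integral_mult_right[OF has_integral_inverse_norm_sq_circlepath[OF R]])
  have "norm (integral {0..1} ?g) \<le> integral {0..1} (\<lambda>x. 2 * pi * M * \<rho> * (1 / (norm (?p x))\<^sup>2))"
  proof (rule integral_norm_bound_integral)
    show "?g integrable_on {0..1}" "(\<lambda>x. 2 * pi * M * \<rho> * (1 / (norm (?p x))\<^sup>2)) integrable_on {0..1}"
      using G H by blast+
    fix x :: real assume x: "x \<in> {0..1}"
    have "norm (vector_derivative ?p (at x within {0..1})) = 2 * pi * \<rho>"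
      using x R by (subst vector_derivative_circlepath01) (auto simp: norm_mult)
    moreover have "norm (g (?p x)) \<le> M / (norm (?p x))\<^sup>2"
      by (rule g) (use R in \<open>simp add: circlepath norm_mult\<close>)
    ultimately have "norm (?g x) \<le> M / (norm (?p x))\<^sup>2 * (2 * pi * \<rho>)"
      using R mult_right_mono[of "norm (g (?p x))" "M / (norm (?p x))\<^sup>2" "2 * pi * \<rho>"]
      by (simp only: norm_mult) auto
    thus "norm (?g x) \<le> 2 * pi * M * \<rho> * (1 / (norm (?p x))\<^sup>2)" by (simp add: mult_ac)
  qed
  thus ?thesis using G H by (simp add: integral_unique)
qed

section \<open>Newton coefficients and the size of their kernel on circles through -b\<close>

text \<open>This is (-1)^k times the k-th forward difference of \<open>f\<close> at 0. The sign
  matches the basis \<open>pochhammer (- z) k / fact k\<close>, which is (-1)^k times the binomial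
  coefficient of z over k.\<close>

definition newton_coeff :: "(complex \<Rightarrow> complex) \<Rightarrow> nat \<Rightarrow> complex" where
  "newton_coeff f k = (\<Sum>j\<le>k. (-1) ^ j * of_nat (k choose j) * f (of_nat j))"

text \<open>The circle touches the line Re w = -b at -b, which is also its point nearest to every
  \<open>r\<close> in [0, R]. The first estimate is sharp there; the second follows from
  \<open>r <= norm (w - r)\<close> and trades a factor for decay in \<open>w\<close>.\<close>

lemma circle_left_geometry:
  fixes w :: complex
  assumes w: "norm (w - of_real R) = R + b" and b: "0 < b" and r: "0 \<le> r" "r \<le> R"
  shows "r + b \<le> norm (w - of_real r)" "norm w \<le> 2 * norm (w - of_real r)" "- b \<le> Re w"
proof -
  have "norm (w - of_real R) \<le> norm (w - of_real r) + norm (complex_of_real r - of_real R)"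
    by (rule order_trans[OF _ norm_triangle_ineq]) simp
  also have "norm (complex_of_real r - of_real R) = R - r"
    using r by (metis norm_of_real of_real_diff abs_minus_commute abs_of_nonneg diff_ge_0_iff_ge)
  finally show *: "r + b \<le> norm (w - of_real r)" using w by simp
  have "norm w \<le> norm (w - of_real r) + norm (complex_of_real r)"
    by (rule order_trans[OF _ norm_triangle_ineq]) simp
  thus "norm w \<le> 2 * norm (w - of_real r)" using * b r by simp
  show "- b \<le> Re w"
    using abs_Re_le_cmod[of "w - of_real R"] w by simp
qed

text \<open>The factors of the product are j - w for j = 0, ..., k. The first \<open>m + 1\<close>
  of them are spent on powers of |w|, and the others are at least j + b, which builds up the
  quotient of the real Pochhammer products.\<close>

lemma pochhammer_circle_lower_bound:
  fixes w :: complex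
  assumes w: "norm (w - of_real R) = R + b" and b: "0 < b" and k: "m \<le> k" "real k \<le> R"
  shows "norm w * (norm w / 2) ^ m * (pochhammer b (Suc k) / pochhammer b (Suc m))
           \<le> norm (pochhammer (- w) (Suc k))"
  using k
proof (induction k rule: dec_induct)
  case base
  have "norm w * (norm w / 2) ^ m \<le> norm (pochhammer (- w) (Suc m))" if "real m \<le> R"
    using that
  proof (induction m)
    case (Suc m)
    have "norm w * (norm w / 2) ^ m * (norm w / 2) \<le> norm (pochhammer (- w) (Suc m)) * norm (w - of_real (real (Suc m)))"
      using Suc circle_left_geometry(2)[OF w b, of "real (Suc m)"] by (intro mult_mono) auto
    thus ?case
      by (simp add: pochhammer_Suc[of _ "Suc m"] norm_mult norm_minus_commute mult_ac del: of_nat_Suc)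
  qed auto
  thus ?case using base b by (simp add: pochhammer_pos less_imp_neq[symmetric])
next
  case (step k)
  have "norm w * (norm w / 2) ^ m * (pochhammer b (Suc k) / pochhammer b (Suc m)) * (real (Suc k) + b)
     \<le> norm (pochhammer (- w) (Suc k)) * norm (w - of_real (real (Suc k)))"
    using step circle_left_geometry(1)[OF w b, of "real (Suc k)"] b by (intro mult_mono) auto
  thus ?case
    by (simp add: pochhammer_Suc[of _ "Suc k"] norm_mult norm_minus_commute mult_ac add_ac del: of_nat_Suc)
qed

text \<open>The quotient times k^b is the sequence in Euler's limit formula for Gamma(b); being
  convergent, it is bounded.\<close>

lemma fact_div_pochhammer_bound:
  fixes b :: real
  assumes "b > 0"
  shows "\<exists>C>0. \<forall>k\<ge>1. fact k / pochhammer b (Suc k) \<le> C * real k powr (- b)"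
proof -
  have "Gamma_series b \<longlonglongrightarrow> Gamma b" by (rule Gamma_series_LIMSEQ)
  hence "Bseq (Gamma_series b)" by (simp add: convergentI convergent_imp_Bseq)
  then obtain C where C: "C > 0" "\<And>k. norm (Gamma_series b k) \<le> C" by (auto simp: Bseq_def)
  have "fact k / pochhammer b (Suc k) \<le> C * real k powr (- b)" if "k \<ge> 1" for k
  proof -
    have "Gamma_series b k = fact k / pochhammer b (Suc k) * real k powr b"
      using that by (simp add: Gamma_series_def powr_def)
    hence "fact k / pochhammer b (Suc k) * real k powr b \<le> C"
      using order_trans[OF abs_ge_self C(2)[of k, unfolded real_norm_def]] by simp
    hence "fact k / pochhammer b (Suc k) * real k powr b * real k powr (- b) \<le> C * real k powr (- b)"
      by (intro mult_right_mono) auto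
    thus ?thesis using that by (simp add: powr_minus field_simps)
  qed
  thus ?thesis using C(1) by blast
qed

lemma circle_weight_le:
  fixes R b :: real
  assumes "0 \<le> R" "0 < b"
  shows "(R + b) / ((R + b)\<^sup>2 - R\<^sup>2) \<le> 1 / b"
proof -
  have "(R + b)\<^sup>2 - R\<^sup>2 = b * (2 * R + b)" by (simp add: power2_eq_square algebra_simps)
  moreover have "(R + b) / (b * (2 * R + b)) \<le> 1 / b"
    using assms by (simp add: divide_simps)
  ultimately show ?thesis by simp
qed

text \<open>The bound is free of \<open>R\<close>, so the circle may grow with the number of nodes
  as long as \<open>M\<close> stays under control.\<close>

lemma contour_integral_bound_circle_left:
  assumes "(g has_contour_integral 2 * of_real pi * \<i> * c) (circlepath (of_real R) (R + b))" and R: "0 \<le> R" "0 < b"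
      and "\<And>w. norm (w - of_real R) = R + b \<Longrightarrow> norm (g w) \<le> M / (norm w)\<^sup>2" and "0 \<le> M"
  shows "norm c \<le> M / b"
proof -
  have "norm (2 * of_real pi * \<i> * c) \<le> 2 * pi * M * (R + b) / ((R + b)\<^sup>2 - R\<^sup>2)"
    by (rule contour_integral_bound_circlepath_norm_sq[OF assms(1)]) (use assms in auto)
  also have "\<dots> = 2 * pi * M * ((R + b) / ((R + b)\<^sup>2 - R\<^sup>2))" by simp
  also have "\<dots> \<le> 2 * pi * M * (1 / b)"
    using circle_weight_le[OF R] assms(5) by (intro mult_left_mono) auto
  finally have "2 * pi * norm c \<le> 2 * pi * (M / b)" by (simp add: norm_mult)
  thus ?thesis by (rule mult_left_le_imp_le) auto
qed

section \<open>Newton coefficients of holomorphic functions\<close>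

context
  fixes f :: "complex \<Rightarrow> complex" and a b :: real
  assumes f: "f holomorphic_on {z. Re z > - a}" and b: "0 < b" "b < a"
begin

lemma Cauchy_circle_left:
  assumes "0 \<le> r" "r \<le> R"
  shows "((\<lambda>w. f w / (w - of_real r)) has_contour_integral 2 * of_real pi * \<i> * f (of_real r))
           (circlepath (of_real R) (R + b))"
proof (rule Cauchy_integral_circlepath_simple)
  show "f holomorphic_on cball (of_real R) (R + b)"
  proof (rule holomorphic_on_subset[OF f], safe)
    fix w :: complex assume "w \<in> cball (of_real R) (R + b)"
    hence "norm (w - of_real R) \<le> R + b" by (simp add: dist_norm norm_minus_commute)
    with abs_Re_le_cmod[of "w - of_real R"] b show "Re w > - a" by simp
  qed
  have "norm (complex_of_real r - of_real R) = R - r"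
    using assms by (metis norm_of_real of_real_diff abs_minus_commute abs_of_nonneg diff_ge_0_iff_ge)
  thus "norm (of_real r - complex_of_real R) < R + b" using assms b by simp
qed

lemma circle_left_avoids_interval:
  assumes "w \<in> path_image (circlepath (of_real R) (R + b))" "0 \<le> r" "r \<le> R"
  shows "w - of_real r \<noteq> 0"
proof -
  have *: "norm (w - of_real R) = R + b"
    using assms b by (auto simp: dist_norm norm_minus_commute)
  show "w - of_real r \<noteq> 0"
    using circle_left_geometry(1)[OF * b(1) assms(2,3)] assms b by auto
qed

text \<open>Cauchy's formula gives each value f(j) as an integral over the same circle; the weighted
  sum of the kernels 1/(w - j) is then collapsed by partial fractions at \<open>x = - w\<close>,
  which accounts for the minus sign.\<close>

lemma newton_coeff_contour_integral:
  assumes k: "real k \<le> R"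
  shows "((\<lambda>w. - (fact k / pochhammer (- w) (Suc k) * f w)) has_contour_integral
           2 * of_real pi * \<i> * newton_coeff f k) (circlepath (of_real R) (R + b))"
proof -
  have "((\<lambda>w. \<Sum>j\<le>k. (-1) ^ j * of_nat (k choose j) * (f w / (w - of_real (real j)))) has_contour_integral
      (\<Sum>j\<le>k. (-1) ^ j * of_nat (k choose j) * (2 * of_real pi * \<i> * f (of_real (real j)))))
      (circlepath (of_real R) (R + b))"
    by (intro has_contour_integral_sum has_contour_integral_lmul Cauchy_circle_left) (use k in auto)
  also have "(\<Sum>j\<le>k. (-1) ^ j * of_nat (k choose j) * (2 * of_real pi * \<i> * f (of_real (real j))))
     = 2 * of_real pi * \<i> * newton_coeff f k"
    by (simp add: newton_coeff_def sum_distrib_left mult_ac)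
  finally show ?thesis
  proof (rule has_contour_integral_eq)
    fix w assume w: "w \<in> path_image (circlepath (of_real R) (R + b))"
    have nz: "- w + of_nat j \<noteq> 0" if "j \<le> k" for j
      using circle_left_avoids_interval[OF w, of "real j"] that k by auto
    have "(\<Sum>j\<le>k. (-1) ^ j * of_nat (k choose j) * (f w / (w - of_real (real j))))
      = - (f w * (\<Sum>j\<le>k. (-1) ^ j * of_nat (k choose j) / (- w + of_nat j)))"
      unfolding sum_distrib_left sum_negf[symmetric]
    proof (rule sum.cong[OF refl])
      fix j assume "j \<in> {..k}"
      hence "- w + of_nat j \<noteq> 0" "w - of_nat j \<noteq> 0" using nz[of j] by auto
      thus "(-1) ^ j * of_nat (k choose j) * (f w / (w - of_real (real j)))
          = - (f w * ((-1) ^ j * of_nat (k choose j) / (- w + of_nat j)))"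
        by (simp add: divide_simps) (simp add: algebra_simps)
    qed
    also have "(\<Sum>j\<le>k. (-1) ^ j * of_nat (k choose j) / (- w + of_nat j)) = fact k / pochhammer (- w) (Suc k)"
      by (rule sum_choose_div_eq_fact_div_pochhammer) (use nz in auto)
    finally show "(\<Sum>j\<le>k. (-1) ^ j * of_nat (k choose j) * (f w / (w - of_real (real j))))
       = - (fact k / pochhammer (- w) (Suc k) * f w)" by (simp add: mult_ac)
  qed
qed

text \<open>Take \<open>R = k\<close> and spend \<open>m + 2\<close> factors of the kernel on powers
  of |w|: \<open>m\<close> of them cancel the growth of \<open>f\<close>, two leave the integrable
  1/|w|^2. The other factors give \<open>fact k / pochhammer b (Suc k)\<close>, of order
  k^(-b).\<close>

lemma newton_coeff_bound:
  assumes bd: "\<And>w. Re w \<ge> - b \<Longrightarrow> norm (f w) \<le> A * (1 + norm w) ^ m"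
  shows "\<exists>C>0. \<forall>k\<ge>1. norm (newton_coeff f k) \<le> C * real k powr (- b)"
proof -
  obtain G where G: "G > 0" "\<And>k. k \<ge> 1 \<Longrightarrow> fact k / pochhammer b (Suc k) \<le> G * real k powr (- b)"
    using fact_div_pochhammer_bound[OF b(1)] by blast
  have A: "A \<ge> 0" using bd[of 0] b order_trans[OF norm_ge_zero[of "f 0"]] by simp
  \<comment> \<open>\<open>(1 / b + 1) ^ m\<close> comes from 1 + |w| <= (1/b + 1)|w| on the circle,
    \<open>2 ^ Suc m\<close> from the halves in the kernel bound, and the last factor replaces the
    Pochhammer factors that were spent on |w|.\<close>
  define D where "D = A * (1 / b + 1) ^ m * 2 ^ Suc m * pochhammer b (Suc (Suc m))"
  have D: "D \<ge> 0" unfolding D_def using A b by (intro mult_nonneg_nonneg) (auto intro: less_imp_le pochhammer_pos)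
  have large: "norm (newton_coeff f k) \<le> (D / b * G) * real k powr (- b)" if k: "k \<ge> Suc m" for k
  proof -
    let ?M = "D * (fact k / pochhammer b (Suc k))"
    have M: "?M \<ge> 0" using D b by (intro mult_nonneg_nonneg divide_nonneg_nonneg) (auto intro: less_imp_le pochhammer_pos)
    have "norm (newton_coeff f k) \<le> ?M / b"
    proof (rule contour_integral_bound_circle_left[OF newton_coeff_contour_integral[OF order_refl] _ b(1) _ M])
      fix w :: complex assume w: "norm (w - of_real (real k)) = real k + b"
      have wb: "b \<le> norm w" using circle_left_geometry(1)[OF w b(1), of 0] by simp
      hence w0: "norm w > 0" using b by linarith
      have Re: "Re w \<ge> - b" using circle_left_geometry(3)[OF w b(1), of 0] by simp
      let ?L = "norm w * (norm w / 2) ^ Suc m * (pochhammer b (Suc k) / pochhammer b (Suc (Suc m)))"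
      have L: "?L \<le> norm (pochhammer (- w) (Suc k))"
        by (rule pochhammer_circle_lower_bound[OF w b(1) k order_refl])
      have pp: "pochhammer b (Suc k) > 0" "pochhammer b (Suc (Suc m)) > 0" using b by (auto intro: pochhammer_pos)
      have L0: "?L > 0" using w0 pp by (intro mult_pos_pos divide_pos_pos zero_less_power) auto
      have "1 + norm w \<le> (1 / b + 1) * norm w"
        using wb b by (simp add: field_simps)
      hence "(1 + norm w) ^ m \<le> ((1 / b + 1) * norm w) ^ m" by (intro power_mono) auto
      hence fw: "norm (f w) \<le> A * ((1 / b + 1) * norm w) ^ m"
        using bd[OF Re] A by (meson mult_left_mono order_trans)
      have "norm (- (fact k / pochhammer (- w) (Suc k) * f w)) = fact k / norm (pochhammer (- w) (Suc k)) * norm (f w)"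
        by (simp add: norm_mult norm_divide)
      also have "\<dots> \<le> fact k / ?L * (A * ((1 / b + 1) * norm w) ^ m)"
      proof (rule mult_mono[OF _ fw])
        show "fact k / norm (pochhammer (- w) (Suc k)) \<le> fact k / ?L"
          by (rule frac_le[OF _ order_refl L0 L]) auto
        show "0 \<le> fact k / ?L" using L0 by (intro divide_nonneg_pos) auto
      qed auto
      also have "\<dots> = ?M / (norm w)\<^sup>2"
        using w0 pp unfolding D_def
        by (simp add: power_mult_distrib power_divide power2_eq_square divide_simps)
      finally show "norm (- (fact k / pochhammer (- w) (Suc k) * f w)) \<le> ?M / (norm w)\<^sup>2" .
    qed auto
    also have "\<dots> = D / b * (fact k / pochhammer b (Suc k))" by simp
    also have "\<dots> \<le> D / b * (G * real k powr (- b))"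
      using G(2)[of k] k D b by (intro mult_left_mono) auto
    finally show ?thesis by (simp add: mult_ac)
  qed
  \<comment> \<open>The finitely many \<open>k <= m\<close>, for which too few kernel factors exist,
    are covered by adding a constant.\<close>
  define S where "S = (\<Sum>k\<le>m. norm (newton_coeff f k) * real k powr b)"
  have S: "S \<ge> 0" unfolding S_def by (intro sum_nonneg) auto
  have "norm (newton_coeff f k) \<le> (D / b * G + S + 1) * real k powr (- b)" if k: "k \<ge> 1" for k
  proof (cases "k \<ge> Suc m")
    case True
    show ?thesis
      by (rule order_trans[OF large[OF True] mult_right_mono]) (use S in auto)
  next
    case False
    have "norm (newton_coeff f k) * real k powr b \<le> S"
      unfolding S_def by (rule member_le_sum) (use False in auto)
    hence "norm (newton_coeff f k) * real k powr b * real k powr (- b) \<le> S * real k powr (- b)"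
      by (intro mult_right_mono) auto
    hence "norm (newton_coeff f k) \<le> S * real k powr (- b)" using k by (simp add: powr_minus field_simps)
    also have "\<dots> \<le> (D / b * G + S + 1) * real k powr (- b)"
      using D G b by (intro mult_right_mono) auto
    finally show ?thesis .
  qed
  moreover have "D / b * G + S + 1 > 0" using D G b S by (intro add_nonneg_pos add_nonneg_nonneg) auto
  ultimately show ?thesis by blast
qed

section \<open>Representation of f by its Newton series on (0, 1)\<close>

text \<open>Newton expansion of the Cauchy kernel. It telescopes, because w - z = (K - z) - (K - w)
  splits each remainder into the next term and the next remainder.\<close>

lemma one_div_diff_newton:
  fixes w z :: complex
  assumes "w \<noteq> z" "\<And>j. j < K \<Longrightarrow> w \<noteq> of_nat j"
  shows "1 / (w - z) = - (\<Sum>k<K. pochhammer (- z) k / pochhammer (- w) (Suc k))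
            + pochhammer (- z) K / (pochhammer (- w) K * (w - z))"
  using assms
proof (induction K)
  case 0
  then show ?case by simp
next
  case (Suc K)
  have "- w + of_nat j \<noteq> 0" if "j < Suc K" for j
    using Suc.prems(2)[OF that] by (simp add: add_eq_0_iff2)
  hence nz: "pochhammer (- w) K \<noteq> 0" "- w + of_nat K \<noteq> 0" "w - z \<noteq> 0"
    using Suc.prems(1) by (auto simp: pochhammer_prod simp del: add_eq_0_iff_both_eq_0)
  have "pochhammer (- z) K / (pochhammer (- w) K * (w - z))
      = pochhammer (- z) (Suc K) / (pochhammer (- w) (Suc K) * (w - z))
        - pochhammer (- z) K / pochhammer (- w) (Suc K)"
    unfolding pochhammer_Suc using nz by (simp add: divide_simps) (simp add: algebra_simps)
  thus ?case using Suc by simp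
qed

lemma norm_pochhammer_minus_le_fact:
  assumes "0 < x" "x < 1"
  shows "norm (pochhammer (- complex_of_real x) (Suc K)) \<le> fact K"
proof (induction K)
  case 0
  then show ?case using assms by simp
next
  case (Suc K)
  have "norm (- complex_of_real x + of_nat (Suc K)) = \<bar>real (Suc K) - x\<bar>"
    by (metis add.commute norm_of_real of_real_diff of_real_of_nat_eq uminus_add_conv_diff)
  also have "\<dots> \<le> real (Suc K)" using assms by simp
  finally have "norm (pochhammer (- complex_of_real x) (Suc K)) * norm (- complex_of_real x + of_nat (Suc K))
      \<le> fact K * real (Suc K)"
    using Suc by (intro mult_mono) auto
  thus ?case by (simp add: pochhammer_Suc[of _ "Suc K"] norm_mult mult_ac del: of_nat_Suc)
qed

text \<open>Integrating \<open>f\<close> against the expanded Cauchy kernel over the circle with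
  \<open>R = K\<close> writes the error of the partial sum as one contour integral, which is of
  order K^(-b). The interval (0, 1) is enough for a later use of the identity theorem.\<close>

lemma newton_series_sums:
  assumes bd: "\<And>w. Re w \<ge> - b \<Longrightarrow> norm (f w) \<le> A" and x: "0 < x" "x < 1"
  shows "(\<lambda>k. newton_coeff f k * pochhammer (- of_real x) k / fact k) sums f (of_real x)"
proof -
  let ?z = "complex_of_real x"
  let ?t = "\<lambda>k. newton_coeff f k * pochhammer (- ?z) k / fact k"
  obtain G where G: "G > 0" "\<And>k. k \<ge> 1 \<Longrightarrow> fact k / pochhammer b (Suc k) \<le> G * real k powr (- b)"
    using fact_div_pochhammer_bound[OF b(1)] by blast
  have A: "A \<ge> 0" using bd[of 0] b order_trans[OF norm_ge_zero[of "f 0"]] by simp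
  have bound: "norm (f ?z - (\<Sum>k<Suc K. ?t k)) \<le> 2 * A * G * real K powr (- b)" if K: "K \<ge> 1" for K
  proof -
    let ?p = "circlepath (of_real (real K)) (real K + b)"
    let ?g = "\<lambda>w. f w * pochhammer (- ?z) (Suc K) / (pochhammer (- w) (Suc K) * (w - ?z))"
    let ?M = "2 * A * b * (fact K / pochhammer b (Suc K))"
    have M: "?M \<ge> 0" using A b by (intro mult_nonneg_nonneg divide_nonneg_nonneg) (auto intro: less_imp_le pochhammer_pos)
    have "((\<lambda>w. f w / (w - ?z) - (\<Sum>k<Suc K. pochhammer (- ?z) k / fact k * - (fact k / pochhammer (- w) (Suc k) * f w)))
       has_contour_integral
         2 * of_real pi * \<i> * f ?z - (\<Sum>k<Suc K. pochhammer (- ?z) k / fact k * (2 * of_real pi * \<i> * newton_coeff f k))) ?p"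
      by (intro has_contour_integral_diff has_contour_integral_sum has_contour_integral_lmul
            newton_coeff_contour_integral Cauchy_circle_left) (use x K in auto)
    also have "2 * of_real pi * \<i> * f ?z - (\<Sum>k<Suc K. pochhammer (- ?z) k / fact k * (2 * of_real pi * \<i> * newton_coeff f k))
       = 2 * of_real pi * \<i> * (f ?z - (\<Sum>k<Suc K. ?t k))"
      unfolding right_diff_distrib sum_distrib_left by (intro arg_cong2[of _ _ _ _ "(-)"] sum.cong refl) auto
    finally have I: "(?g has_contour_integral 2 * of_real pi * \<i> * (f ?z - (\<Sum>k<Suc K. ?t k))) ?p"
    proof (rule has_contour_integral_eq)
      fix w assume w: "w \<in> path_image ?p"
      have "w \<noteq> ?z" "w \<noteq> of_nat j" if "j < Suc K" for j
        using circle_left_avoids_interval[OF w, of x] circle_left_avoids_interval[OF w, of "real j"] that x K by auto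
      hence eq: "1 / (w - ?z) = - (\<Sum>k<Suc K. pochhammer (- ?z) k / pochhammer (- w) (Suc k))
            + pochhammer (- ?z) (Suc K) / (pochhammer (- w) (Suc K) * (w - ?z))"
        by (intro one_div_diff_newton) auto
      have "f w / (w - ?z) = f w * (1 / (w - ?z))" by simp
      also have "\<dots> = (\<Sum>k<Suc K. pochhammer (- ?z) k / fact k * - (fact k / pochhammer (- w) (Suc k) * f w)) + ?g w"
        unfolding eq distrib_left
        by (intro arg_cong2[of _ _ _ _ "(+)"])
           (auto simp: sum_distrib_left sum_negf[symmetric] simp del: sum.lessThan_Suc intro!: sum.cong)
      finally show "f w / (w - ?z) - (\<Sum>k<Suc K. pochhammer (- ?z) k / fact k * - (fact k / pochhammer (- w) (Suc k) * f w)) = ?g w"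
        by (simp only: add_diff_cancel_left')
    qed
    have "norm (f ?z - (\<Sum>k<Suc K. ?t k)) \<le> ?M / b"
    proof (rule contour_integral_bound_circle_left[OF I _ b(1) _ M])
      fix w :: complex assume w: "norm (w - of_real (real K)) = real K + b"
      have wb: "b \<le> norm w" using circle_left_geometry(1)[OF w b(1), of 0] by simp
      hence w0: "norm w > 0" using b by linarith
      have fw: "norm (f w) \<le> A" using circle_left_geometry(3)[OF w b(1), of 0] by (intro bd) simp
      \<comment> \<open>For bounded \<open>f\<close> a single |w| from the Pochhammer product
        suffices, since |w - x| >= |w|/2 supplies the second one.\<close>
      let ?L = "norm w * (pochhammer b (Suc K) / b)"
      have L: "?L \<le> norm (pochhammer (- w) (Suc K))"
        using pochhammer_circle_lower_bound[OF w b(1), of 0 K] by simp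
      have wz: "norm w / 2 \<le> norm (w - ?z)"
        using circle_left_geometry(2)[OF w b(1), of x] x K by simp
      have pp: "pochhammer b (Suc K) > 0" using b by (auto intro: pochhammer_pos)
      have L0: "?L > 0" using w0 pp b by (intro mult_pos_pos divide_pos_pos) auto
      have "norm (?g w) = norm (f w) * norm (pochhammer (- ?z) (Suc K)) / (norm (pochhammer (- w) (Suc K)) * norm (w - ?z))"
        by (simp add: norm_mult norm_divide)
      also have "\<dots> \<le> A * fact K / (?L * (norm w / 2))"
      proof (rule frac_le)
        show "norm (f w) * norm (pochhammer (- ?z) (Suc K)) \<le> A * fact K"
          by (intro mult_mono fw norm_pochhammer_minus_le_fact x A) auto
        show "?L * (norm w / 2) \<le> norm (pochhammer (- w) (Suc K)) * norm (w - ?z)"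
          by (intro mult_mono L wz) (use w0 in auto)
        show "0 < ?L * (norm w / 2)" by (rule mult_pos_pos[OF L0]) (use w0 in auto)
      qed (use A in auto)
      also have "\<dots> = ?M / (norm w)\<^sup>2"
        using w0 pp b by (simp add: power2_eq_square divide_simps)
      finally show "norm (?g w) \<le> ?M / (norm w)\<^sup>2" .
    qed auto
    also have "?M / b = 2 * A * (fact K / pochhammer b (Suc K))" using b by simp
    also have "\<dots> \<le> 2 * A * (G * real K powr (- b))"
      using G(2)[OF K] A by (intro mult_left_mono) auto
    finally show ?thesis by (simp only: mult.assoc)
  qed
  have "(\<lambda>K. 2 * A * G * real K powr (- b)) \<longlonglongrightarrow> 2 * A * G * 0"
    by (intro tendsto_intros tendsto_neg_powr filterlim_real_sequentially) (use b in auto)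
  hence "(\<lambda>K. 2 * A * G * real K powr (- b)) \<longlonglongrightarrow> 0" by simp
  moreover have "eventually (\<lambda>K. norm (f ?z - (\<Sum>k<Suc K. ?t k)) \<le> 2 * A * G * real K powr (- b)) sequentially"
    using eventually_ge_at_top[of "1::nat"] by eventually_elim (rule bound)
  ultimately have "(\<lambda>K. f ?z - (\<Sum>k<Suc K. ?t k)) \<longlonglongrightarrow> 0"
    by (rule Lim_null_comparison[rotated])
  hence "(\<lambda>K. f ?z - (f ?z - (\<Sum>k<Suc K. ?t k))) \<longlonglongrightarrow> f ?z - 0"
    by (intro tendsto_intros)
  hence "(\<lambda>K. \<Sum>k<Suc K. ?t k) \<longlonglongrightarrow> f ?z" by (simp only: diff_diff_eq2 diff_zero add_diff_cancel_left')
  thus ?thesis unfolding sums_def by (subst (asm) filterlim_sequentially_Suc)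
qed

end

section \<open>Growth of the Newton basis and convergence of Newton series\<close>

text \<open>After squaring this is 1 + t <= exp t. No logarithm is taken, so factors that vanish
  need no special treatment.\<close>

lemma norm_one_minus_le_exp: "norm (1 - v :: complex) \<le> exp (- Re v + (norm v)\<^sup>2 / 2)"
proof -
  have "(norm (1 - v))\<^sup>2 = 1 + (- 2 * Re v + (norm v)\<^sup>2)"
    unfolding cmod_power2 by (simp add: power2_eq_square algebra_simps)
  also have "\<dots> \<le> exp (- 2 * Re v + (norm v)\<^sup>2)" by (rule exp_ge_add_one_self)
  also have "\<dots> = (exp (- Re v + (norm v)\<^sup>2 / 2))\<^sup>2"
    by (simp add: power2_eq_square exp_add[symmetric])
  finally show ?thesis by (rule power2_le_imp_le) simp
qed

lemma sum_inverse_squares_le: "(\<Sum>r=1..n. 1 / (real r)\<^sup>2) \<le> 2 - 1 / real n"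
proof (induction n)
  case (Suc n)
  \<comment> \<open>The telescoping comparison fails at \<open>n = 0\<close>, where
    \<open>1 / real 0 = 0\<close>; that step is a direct evaluation.\<close>
  have "1 / (real (Suc n))\<^sup>2 \<le> 1 / real n - 1 / real (Suc n)" if "n > 0"
    using that by (simp add: divide_simps power2_eq_square)
  with Suc show ?case by (cases "n = 0") auto
qed simp

text \<open>With u = z + 1 the quotient is the product of 1 - u/r over r = 1, ..., k. The linear
  terms sum to Re u times a harmonic number, hence to the power of \<open>k\<close>; the quadratic
  ones converge. The constant depends on |z + 1| alone, so the estimate is locally uniform.\<close>

lemma norm_pochhammer_div_fact_le:
  fixes z :: complex
  assumes k: "k \<ge> 1"
  shows "norm (pochhammer (- z) k / fact k) \<le> exp ((norm (z + 1))\<^sup>2 + norm (z + 1)) * real k powr (- Re z - 1)"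
proof -
  define u where "u = z + 1"
  have "pochhammer (- z) k / fact k = (\<Prod>r=1..k. 1 - u / of_nat r)"
  proof (induction k)
    case (Suc k)
    have "pochhammer (- z) (Suc k) / fact (Suc k) = pochhammer (- z) k / fact k * (1 - u / of_nat (Suc k))"
      by (simp add: pochhammer_Suc u_def divide_simps del: of_nat_Suc) (simp add: algebra_simps)
    thus ?case using Suc by simp
  qed simp
  hence "norm (pochhammer (- z) k / fact k) = (\<Prod>r=1..k. norm (1 - u / of_nat r))"
    by (simp add: prod_norm)
  also have "\<dots> \<le> (\<Prod>r=1..k. exp (- Re u * inverse (real r) + (norm u)\<^sup>2 / 2 * (1 / (real r)\<^sup>2)))"
  proof (rule prod_mono, safe)
    fix r assume "r \<in> {1..k}"
    show "norm (1 - u / of_nat r) \<le> exp (- Re u * inverse (real r) + (norm u)\<^sup>2 / 2 * (1 / (real r)\<^sup>2))"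
      using norm_one_minus_le_exp[of "u / of_nat r"]
      by (simp add: norm_divide power_divide field_simps)
  qed auto
  also have "\<dots> = exp (\<Sum>r=1..k. - Re u * inverse (real r) + (norm u)\<^sup>2 / 2 * (1 / (real r)\<^sup>2))"
    by (subst exp_sum) auto
  also have "(\<Sum>r=1..k. - Re u * inverse (real r) + (norm u)\<^sup>2 / 2 * (1 / (real r)\<^sup>2))
      = - Re u * harm k + (norm u)\<^sup>2 / 2 * (\<Sum>r=1..k. 1 / (real r)\<^sup>2)"
    unfolding harm_def sum.distrib sum_distrib_left ..
  also have "exp (- Re u * harm k + (norm u)\<^sup>2 / 2 * (\<Sum>r=1..k. 1 / (real r)\<^sup>2)) \<le> exp (norm u + (norm u)\<^sup>2 - Re u * ln (real k))"
  \<comment> \<open>The harmonic number exceeds ln k by an amount between 0 and 1, which costs at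
    most |u| in the exponent.\<close>
  proof -
    have "0 \<le> harm k - ln (real k)"
      using order_trans[OF _ ln_le_harm[of k], of "ln (real k)"] k by simp
    moreover have "harm k - ln (real k) \<le> 1"
      using euler_mascheroni_sequence_decreasing[of 1 k] k by (simp add: harm_expand)
    ultimately have "\<bar>Re u * (harm k - ln (real k))\<bar> \<le> norm u * 1"
      unfolding abs_mult using abs_Re_le_cmod[of u] by (intro mult_mono) auto
    moreover have "(norm u)\<^sup>2 / 2 * (\<Sum>r=1..k. 1 / (real r)\<^sup>2) \<le> (norm u)\<^sup>2 / 2 * 2"
      using sum_inverse_squares_le[of k] by (intro mult_left_mono) (auto intro: order_trans)
    ultimately show ?thesis by (simp add: algebra_simps)
  qed
  also have "\<dots> = exp ((norm u)\<^sup>2 + norm u) * real k powr (- Re z - 1)"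
    using k by (simp add: powr_def u_def exp_add[symmetric] algebra_simps)
  finally show ?thesis by (simp add: u_def)
qed

text \<open>The k-th term is of order k^(-\<alpha> + \<epsilon> - Re z - 1), which is summable,
  locally uniformly in z, once \<epsilon> is below the distance to the boundary line.\<close>

lemma newton_series_holomorphic:
  fixes c :: "nat \<Rightarrow> complex"
  assumes c: "\<And>\<epsilon>. \<epsilon> > 0 \<Longrightarrow> \<exists>C. \<forall>k\<ge>1. norm (c k) \<le> C * real k powr (- \<alpha> + \<epsilon>)"
  shows "(\<lambda>z. \<Sum>k. c k * (pochhammer (- z) k / fact k)) holomorphic_on {z. Re z > - \<alpha>}"
proof -
  let ?A = "{z. Re z > - \<alpha>}"
  have ul: "\<exists>d>0. cball z d \<subseteq> ?A \<and>
       uniform_limit (cball z d) (\<lambda>N s. \<Sum>k<N. c k * (pochhammer (- s) k / fact k))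
         (\<lambda>s. \<Sum>k. c k * (pochhammer (- s) k / fact k)) sequentially"
    if z: "z \<in> ?A" for z
  proof -
    \<comment> \<open>Half the distance to the boundary: the disc keeps Re s >= -\<alpha> + d, and
      the choice d/2 for \<epsilon> leaves the exponent -1 - d/2.\<close>
    define d where "d = (Re z + \<alpha>) / 2"
    define B where "B = norm z + d + 1"
    have d: "d > 0" using z by (simp add: d_def)
    obtain C where C: "\<And>k. k \<ge> 1 \<Longrightarrow> norm (c k) \<le> C * real k powr (- \<alpha> + d / 2)"
      using c[of "d / 2"] d by auto
    have C0: "C \<ge> 0" using order_trans[OF norm_ge_zero C[of 1]] by simp
    \<comment> \<open>Index 0 is treated apart, since \<open>0 powr _ = 0\<close> while the term
      itself is \<open>c 0\<close>.\<close>
    define M where "M = (\<lambda>k. C * exp (B\<^sup>2 + B) * real k powr (- 1 - d / 2) + (if k = 0 then norm (c 0) else 0))"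
    have Re: "Re s \<ge> - \<alpha> + d" if "s \<in> cball z d" for s
      using that abs_Re_le_cmod[of "z - s"] by (simp add: dist_norm d_def)
    have bd: "norm (c k * (pochhammer (- s) k / fact k)) \<le> M k" if s: "s \<in> cball z d" for s k
    proof (cases "k = 0")
      case False
      hence k: "k \<ge> 1" by simp
      have "norm (s + 1) \<le> norm s + 1" by (metis norm_triangle_ineq norm_one)
      moreover have "norm s \<le> norm z + d"
        using s norm_triangle_ineq2[of s z] by (simp add: dist_norm norm_minus_commute)
      ultimately have sB: "norm (s + 1) \<le> B" by (simp add: B_def)
      have "norm (pochhammer (- s) k / fact k) \<le> exp ((norm (s + 1))\<^sup>2 + norm (s + 1)) * real k powr (- Re s - 1)"
        by (rule norm_pochhammer_div_fact_le[OF k])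
      also have "\<dots> \<le> exp (B\<^sup>2 + B) * real k powr (\<alpha> - d - 1)"
      proof (rule mult_mono)
        show "exp ((norm (s + 1))\<^sup>2 + norm (s + 1)) \<le> exp (B\<^sup>2 + B)"
          using sB by (simp add: add_mono power_mono)
        show "real k powr (- Re s - 1) \<le> real k powr (\<alpha> - d - 1)"
          using Re[OF s] k by (intro powr_mono) auto
      qed auto
      finally have "norm (c k * (pochhammer (- s) k / fact k))
          \<le> (C * real k powr (- \<alpha> + d / 2)) * (exp (B\<^sup>2 + B) * real k powr (\<alpha> - d - 1))"
        unfolding norm_mult using C[OF k] C0 by (intro mult_mono) auto
      also have "\<dots> = C * exp (B\<^sup>2 + B) * (real k powr (- \<alpha> + d / 2) * real k powr (\<alpha> - d - 1))"
        by simp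
      also have "real k powr (- \<alpha> + d / 2) * real k powr (\<alpha> - d - 1) = real k powr (- 1 - d / 2)"
        by (subst powr_add[symmetric]) (simp add: algebra_simps)
      finally show ?thesis using False by (simp add: M_def)
    qed (simp add: M_def)
    have "summable M"
      unfolding M_def
      by (rule summable_add[OF summable_mult summable_If_finite]) (use d in \<open>simp_all add: summable_real_powr_iff\<close>)
    with bd have "uniform_limit (cball z d) (\<lambda>N s. \<Sum>k<N. c k * (pochhammer (- s) k / fact k))
         (\<lambda>s. \<Sum>k. c k * (pochhammer (- s) k / fact k)) sequentially"
      by (rule Weierstrass_m_test[where f = "\<lambda>k s. c k * (pochhammer (- s) k / fact k)"])
    moreover have "cball z d \<subseteq> ?A" using Re d by force
    ultimately show ?thesis using d by blast
  qed
  show ?thesis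
  proof (rule holomorphic_uniform_sequence[OF open_halfspace_Re_gt, where f = "\<lambda>N s. \<Sum>k<N. c k * (pochhammer (- s) k / fact k)"])
    fix N :: nat
    show "(\<lambda>s. \<Sum>k<N. c k * (pochhammer (- s) k / fact k)) holomorphic_on ?A"
      unfolding pochhammer_prod by (intro holomorphic_intros) auto
  qed (use ul in blast)
qed

section \<open>Growth of zeta and its reciprocal\<close>

lemma zeta_minus_one_sums:
  assumes "Re s > 1"
  shows "(\<lambda>n. 1 / of_nat (Suc (Suc n)) powr s) sums (zeta s - 1)"
  using zeta_sums[OF assms] by (subst sums_Suc_iff) simp

lemma norm_one_div_powr: "norm (1 / of_nat (Suc n) powr s :: complex) = real (Suc n) powr (- Re s)"
  unfolding norm_divide norm_one powr_minus
  by (subst norm_powr_real_powr) (auto simp: divide_inverse)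

lemma norm_zeta_minus_one_le:
  assumes "\<sigma> > 1" "Re s \<ge> \<sigma>"
  shows "norm (zeta s - 1) \<le> norm (zeta (of_real \<sigma>)) - 1"
proof -
  let ?a = "\<lambda>n. real (Suc (Suc n)) powr (- \<sigma>)"
  have "complex_of_real (?a n) = 1 / of_nat (Suc (Suc n)) powr of_real \<sigma>" for n
    using powr_of_real[of "real (Suc (Suc n))" \<sigma>]
    by (simp add: powr_minus divide_inverse del: of_nat_Suc)
  hence "(\<lambda>n. complex_of_real (?a n)) sums (zeta (of_real \<sigma>) - 1)"
    using zeta_minus_one_sums[of "of_real \<sigma>"] assms by (simp del: of_nat_Suc)
  hence a: "?a sums Re (zeta (of_real \<sigma>) - 1)" 
    using sums_Re by fastforce
  have "norm (zeta s - 1) \<le> Re (zeta (of_real \<sigma>) - 1)"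
  proof (rule norm_sums_le[OF zeta_minus_one_sums a])
    show "norm (1 / of_nat (Suc (Suc n)) powr s :: complex) \<le> ?a n" for n
      unfolding norm_one_div_powr using assms by (intro powr_mono) auto
  qed (use assms in auto)
  thus ?thesis using complex_Re_le_cmod[of "zeta (of_real \<sigma>)"] by simp
qed

text \<open>Comparison of 1/n^2 with the telescoping 1/(n - 1) - 1/n. Strictness is the point: it
  leaves room to move left of 2 by continuity.\<close>

lemma norm_zeta_2_less: "norm (zeta 2) < 2"
proof -
  let ?a = "\<lambda>n. 1 / real (Suc (Suc n)) ^ 2"
  let ?b = "\<lambda>n. 1 / real (Suc n) - 1 / real (Suc (Suc n))"
  have z: "(\<lambda>n. 1 / of_nat (Suc (Suc n)) powr 2) sums (zeta 2 - 1)"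
    by (rule zeta_minus_one_sums) simp
  have "(\<lambda>n. 1 / real (Suc n)) \<longlonglongrightarrow> 0" using LIMSEQ_inverse_real_of_nat by (simp add: inverse_eq_divide)
  from telescope_sums'[OF this] have b: "?b sums 1" by simp
  have le: "?a n \<le> ?b n" for n by (simp add: divide_simps power2_eq_square)
  have sa: "summable ?a"
    by (rule summable_comparison_test'[OF sums_summable[OF b], of 0]) (use le in auto)
  have "norm (zeta 2 - 1) \<le> suminf ?a"
  proof (rule norm_sums_le[OF z summable_sums[OF sa]])
    show "norm (1 / of_nat (Suc (Suc n)) powr 2 :: complex) \<le> ?a n" for n
      unfolding norm_one_div_powr by (simp add: powr_minus divide_inverse del: of_nat_Suc)
  qed
  \<comment> \<open>The comparison is strict already at index 0, where 1/4 < 1/2.\<close>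
  moreover have "0 < (\<Sum>n. ?b n - ?a n)"
    by (rule suminf_pos2[of _ 0]) (use le sa b in \<open>auto intro: summable_diff sums_summable simp: sums_iff\<close>)
  hence "suminf ?a < 1"
    using suminf_diff[OF sums_summable[OF b] sa] b by (simp add: sums_iff)
  ultimately have "norm (zeta 2 - 1) < 1" by simp
  thus ?thesis using norm_triangle_ineq[of "zeta 2 - 1" 1] by simp
qed

text \<open>By continuity |zeta| < 2 still holds at some real point 2 - \<eta>, and the terms of the
  Dirichlet series to the right of it are dominated by those there. The margin \<eta> provides an
  unconditional strip to the left of Re s = 2.\<close>

lemma zeta_lower_bound:
  obtains \<eta> \<kappa> :: real where "0 < \<eta>" "\<eta> < 1" "0 < \<kappa>" "\<And>s. Re s \<ge> 2 - \<eta> \<Longrightarrow> norm (zeta s) \<ge> \<kappa>"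
proof -
  have "isCont zeta 2"
    by (rule continuous_on_interior[OF holomorphic_on_imp_continuous_on[OF holomorphic_zeta]])
       (simp add: interior_open open_delete[of UNIV, simplified, folded Compl_eq_Diff_UNIV])
  hence "(\<lambda>s. norm (zeta s)) \<midarrow>2\<rightarrow> norm (zeta 2)" by (auto simp: isCont_def intro: tendsto_norm)
  from order_tendstoD(2)[OF this norm_zeta_2_less]
  obtain d where d: "d > 0" "\<And>s. s \<noteq> 2 \<Longrightarrow> dist s 2 < d \<Longrightarrow> norm (zeta s) < 2"
    by (auto simp: eventually_at)
  \<comment> \<open>The cap 1/2 keeps 2 - \<eta> above 1, where the Dirichlet series
    converges.\<close>
  define \<eta> where "\<eta> = min (d / 2) (1 / 2)"
  have \<eta>: "\<eta> > 0" "\<eta> < 1" "\<eta> < d" using d(1) by (auto simp: \<eta>_def)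
  have "dist (complex_of_real (2 - \<eta>)) 2 = \<eta>"
    using \<eta> by (simp add: dist_norm)
  hence "norm (zeta (of_real (2 - \<eta>))) < 2" using \<eta> by (intro d(2)) auto
  show ?thesis
  proof (rule that[of \<eta> "2 - norm (zeta (of_real (2 - \<eta>)))"])
    fix s assume "Re s \<ge> 2 - \<eta>"
    hence "norm (zeta s - 1) \<le> norm (zeta (of_real (2 - \<eta>))) - 1"
      using \<eta> by (intro norm_zeta_minus_one_le) auto
    thus "2 - norm (zeta (of_real (2 - \<eta>))) \<le> norm (zeta s)"
      using norm_triangle_ineq2[of 1 "1 - zeta s"] by (simp add: norm_minus_commute)
  qed (use \<eta> \<open>norm (zeta (of_real (2 - \<eta>))) < 2\<close> in auto)
qed

section \<open>Lower bounds for functions without zeros in a disc\<close>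

text \<open>
  Borel--Caratheodory: a logarithm of \<open>F\<close> maps into a half-plane, and the Schwarz lemma applies after
  a Moebius transformation onto the disc.
\<close>

lemma holomorphic_nonzero_lower_bound:
  assumes F: "F holomorphic_on ball c R" and R: "0 < r" "r < R"
    and nz: "\<And>z. z \<in> ball c R \<Longrightarrow> F z \<noteq> 0" and M: "\<And>z. z \<in> ball c R \<Longrightarrow> norm (F z) < M"
    and N: "2 * r / (R - r) \<le> real N" and z: "z \<in> cball c r"
  shows "norm (F c) * (norm (F c) / M) ^ N \<le> norm (F z)"
proof -
  obtain G where G: "G holomorphic_on ball c R" "\<And>z. z \<in> ball c R \<Longrightarrow> F z = exp (G z)"
    using contractible_imp_holomorphic_log[OF F convex_imp_contractible[OF convex_ball] nz] by metis
  have c: "c \<in> ball c R" using R by simp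
  define U where "U = ln (M / norm (F c))"
  have Fc: "norm (F c) > 0" "norm (F c) < M" using nz[OF c] M[OF c] by auto
  hence U: "U > 0" unfolding U_def by (intro ln_gt_zero) simp
  define h where "h = (\<lambda>w. G (c + of_real R * w) - G c)"
  have inb: "c + of_real R * w \<in> ball c R" if "norm w < 1" for w
    using that R by (simp add: dist_norm norm_mult)
  have Reh: "Re (h w) < U" if w: "norm w < 1" for w
  proof -
    have "norm (F (c + of_real R * w)) = exp (Re (G (c + of_real R * w)))" "norm (F c) = exp (Re (G c))"
      using G(2)[OF inb[OF w]] G(2)[OF c] by auto
    hence "exp (Re (h w)) = norm (F (c + of_real R * w)) / norm (F c)"
      by (simp add: h_def exp_diff)
    also have "\<dots> < M / norm (F c)"
      using M[OF inb[OF w]] Fc by (simp add: divide_strict_right_mono)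
    finally have "ln (exp (Re (h w))) < U"
      unfolding U_def using less_trans[OF exp_gt_zero] by (subst ln_less_cancel_iff) auto
    thus ?thesis by simp
  qed
  \<comment> \<open>2U is the reflection of 0 in the line Re = U, so points to the left of that line
    are closer to 0.\<close>
  have lt: "norm (h w) < norm (2 * of_real U - h w)" if "norm w < 1" for w
  proof -
    have "(norm (2 * of_real U - h w))\<^sup>2 - (norm (h w))\<^sup>2 = 4 * U * (U - Re (h w))"
      unfolding cmod_power2 by (simp add: power2_eq_square algebra_simps)
    also have "\<dots> > 0" using U Reh[OF that] by simp
    finally show ?thesis by (simp add: power2_less_imp_less)
  qed
  \<comment> \<open>The Moebius map v/(2U - v) takes Re v < U to the unit disc and fixes 0.\<close>
  define \<phi> where "\<phi> = (\<lambda>w. h w / (2 * of_real U - h w))"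
  define w where "w = (z - c) / of_real R"
  have zw: "z = c + of_real R * w" using R by (simp add: w_def)
  have "norm w = norm (z - c) / R" using R by (simp add: w_def norm_divide)
  also have "\<dots> \<le> r / R" using z R by (intro divide_right_mono) (auto simp: dist_norm norm_minus_commute)
  finally have w: "norm w \<le> r / R" .
  also have "r / R < 1" using R by simp
  finally have w1: "norm w < 1" .
  have holh: "h holomorphic_on ball 0 1"
    unfolding h_def
    by (intro holomorphic_intros holomorphic_on_compose_gen[OF _ G(1), unfolded o_def]) (use inb in auto)
  have "norm (\<phi> w) \<le> norm w"
  proof (rule Schwarz_Lemma(1)[OF _ _ _ w1])
    show "\<phi> holomorphic_on ball 0 1"
      unfolding \<phi>_def by (intro holomorphic_intros holh) (use lt in force)
    show "\<phi> 0 = 0" by (simp add: \<phi>_def h_def)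
    show "norm (\<phi> v) < 1" if "norm v < 1" for v
      using lt[OF that] by (simp add: \<phi>_def norm_divide divide_less_eq)

  qed
  hence "norm (h w) \<le> norm w * norm (2 * of_real U - h w)"
    using lt[OF w1] by (auto simp: \<phi>_def norm_divide divide_le_eq split: if_splits)
  also have "\<dots> \<le> norm w * (2 * U + norm (h w))"
    using norm_triangle_ineq4[of "2 * of_real U" "h w"] U by (intro mult_left_mono) auto
  also have "\<dots> \<le> r / R * (2 * U + norm (h w))"
    using w U by (intro mult_right_mono) auto
  finally have "norm (h w) * R \<le> r * (2 * U + norm (h w))" 
    using R by (simp add: field_simps)
  hence "norm (h w) \<le> 2 * r / (R - r) * U" using R by (simp add: field_simps)
  \<comment> \<open>Rounding the factor up to a natural number makes the final bound an integer
    power, so polynomial bounds stay polynomial.\<close>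
  also have "\<dots> \<le> real N * U" using N U by (intro mult_right_mono) auto
  finally have hN: "- (real N * U) \<le> Re (h w)" using abs_Re_le_cmod[of "h w"] by linarith
  have "norm (F z) = norm (F c) * exp (Re (h w))"
    using G(2)[OF inb[OF w1]] G(2)[OF c] by (simp add: zw h_def exp_diff)
  moreover have "exp U = M / norm (F c)"
    unfolding U_def by (rule exp_ln) (use less_trans[OF Fc] Fc(1) in simp)
  hence "(norm (F c) / M) ^ N = exp (- (real N * U))"
    by (simp add: exp_minus exp_of_nat_mult power_divide)
  ultimately show ?thesis using hN by (simp add: mult_left_mono)
qed

section \<open>Calculus of polynomially bounded functions\<close>

text \<open>The base \<open>1 + norm s\<close> is at least 1, so exponents can be raised freely;
  sums then cause no trouble near 0.\<close>

definition poly_bounded_on :: "complex set \<Rightarrow> (complex \<Rightarrow> complex) \<Rightarrow> bool" where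
  "poly_bounded_on S g \<longleftrightarrow> (\<exists>A m. \<forall>s\<in>S. norm (g s) \<le> A * (1 + norm s) ^ m)"

lemma poly_bounded_onI:
  assumes "\<And>s. s \<in> S \<Longrightarrow> norm (g s) \<le> A * (1 + norm s) ^ m"
  shows "poly_bounded_on S g"
  using assms unfolding poly_bounded_on_def by blast

lemma poly_bounded_onE:
  assumes "poly_bounded_on S g"
  obtains A m where "A > 0" "\<And>s. s \<in> S \<Longrightarrow> norm (g s) \<le> A * (1 + norm s) ^ m"
proof -
  obtain A m where A: "\<And>s. s \<in> S \<Longrightarrow> norm (g s) \<le> A * (1 + norm s) ^ m"
    using assms unfolding poly_bounded_on_def by blast
  show ?thesis
  proof (rule that[of "\<bar>A\<bar> + 1" m])
    fix s assume "s \<in> S"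
    from A[OF this] show "norm (g s) \<le> (\<bar>A\<bar> + 1) * (1 + norm s) ^ m"
      by (rule order_trans) (auto intro!: mult_right_mono)
  qed auto
qed

lemma poly_bounded_on_subset: "poly_bounded_on T g \<Longrightarrow> S \<subseteq> T \<Longrightarrow> poly_bounded_on S g"
  unfolding poly_bounded_on_def by blast

lemma poly_bounded_on_le:
  "poly_bounded_on S g \<Longrightarrow> (\<And>s. s \<in> S \<Longrightarrow> norm (h s) \<le> norm (g s)) \<Longrightarrow> poly_bounded_on S h"
  unfolding poly_bounded_on_def by (meson order_trans)

lemma poly_bounded_on_const: "poly_bounded_on S (\<lambda>_. c)"
  by (rule poly_bounded_onI[of _ _ "norm c" 0]) auto

lemma poly_bounded_on_id: "poly_bounded_on S (\<lambda>s. s)"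
  by (rule poly_bounded_onI[of _ _ 1 1]) auto

lemma poly_bounded_on_mult:
  assumes "poly_bounded_on S g" "poly_bounded_on S h"
  shows "poly_bounded_on S (\<lambda>s. g s * h s)"
proof -
  obtain A m where A: "A > 0" "\<And>s. s \<in> S \<Longrightarrow> norm (g s) \<le> A * (1 + norm s) ^ m"
    using poly_bounded_onE[OF assms(1)] by blast
  obtain B n where B: "B > 0" "\<And>s. s \<in> S \<Longrightarrow> norm (h s) \<le> B * (1 + norm s) ^ n"
    using poly_bounded_onE[OF assms(2)] by blast
  show ?thesis
  proof (rule poly_bounded_onI)
    fix s assume s: "s \<in> S"
    have "norm (g s * h s) \<le> (A * (1 + norm s) ^ m) * (B * (1 + norm s) ^ n)"
      unfolding norm_mult by (intro mult_mono A B s) (use A in auto)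
    thus "norm (g s * h s) \<le> (A * B) * (1 + norm s) ^ (m + n)"
      by (simp add: power_add mult_ac)
  qed
qed

lemma poly_bounded_on_add:
  assumes "poly_bounded_on S g" "poly_bounded_on S h"
  shows "poly_bounded_on S (\<lambda>s. g s + h s)"
proof -
  obtain A m where A: "A > 0" "\<And>s. s \<in> S \<Longrightarrow> norm (g s) \<le> A * (1 + norm s) ^ m"
    using poly_bounded_onE[OF assms(1)] by blast
  obtain B n where B: "B > 0" "\<And>s. s \<in> S \<Longrightarrow> norm (h s) \<le> B * (1 + norm s) ^ n"
    using poly_bounded_onE[OF assms(2)] by blast
  show ?thesis
  proof (rule poly_bounded_onI)
    fix s assume s: "s \<in> S"
    have "(1 + norm s) ^ m \<le> (1 + norm s) ^ (m + n)" "(1 + norm s) ^ n \<le> (1 + norm s) ^ (m + n)"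
      by (intro power_increasing; simp)+
    hence "A * (1 + norm s) ^ m + B * (1 + norm s) ^ n \<le> (A + B) * (1 + norm s) ^ (m + n)"
      unfolding distrib_right using A(1) B(1) by (intro add_mono mult_left_mono) auto
    thus "norm (g s + h s) \<le> (A + B) * (1 + norm s) ^ (m + n)"
      using norm_triangle_ineq[of "g s" "h s"] A(2)[OF s] B(2)[OF s] by linarith
  qed
qed

lemma poly_bounded_on_diff:
  assumes "poly_bounded_on S g" "poly_bounded_on S h"
  shows "poly_bounded_on S (\<lambda>s. g s - h s)"
  using poly_bounded_on_add[OF assms(1) poly_bounded_on_mult[OF poly_bounded_on_const[of S "-1"] assms(2)]]
  by simp

lemma poly_bounded_on_sum:
  assumes "\<And>i. i \<in> I \<Longrightarrow> poly_bounded_on S (g i)"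
  shows "poly_bounded_on S (\<lambda>s. \<Sum>i\<in>I. g i s)"
  using assms
  by (induction I rule: infinite_finite_induct) (auto intro: poly_bounded_on_const poly_bounded_on_add)

lemma poly_bounded_on_prod:
  assumes "\<And>i. i \<in> I \<Longrightarrow> poly_bounded_on S (g i)"
  shows "poly_bounded_on S (\<lambda>s. \<Prod>i\<in>I. g i s)"
  using assms
  by (induction I rule: infinite_finite_induct) (auto intro: poly_bounded_on_const poly_bounded_on_mult)

lemma poly_bounded_on_shift:
  assumes "poly_bounded_on T g" "\<And>s. s \<in> S \<Longrightarrow> s + c \<in> T"
  shows "poly_bounded_on S (\<lambda>s. g (s + c))"
proof -
  obtain A m where A: "A > 0" "\<And>s. s \<in> T \<Longrightarrow> norm (g s) \<le> A * (1 + norm s) ^ m"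
    using poly_bounded_onE[OF assms(1)] by blast
  show ?thesis
  proof (rule poly_bounded_onI)
    fix s assume s: "s \<in> S"
    have "1 + norm (s + c) \<le> (1 + norm c) * (1 + norm s)"
    proof -
      have "(1 + norm c) * (1 + norm s) = 1 + norm c + norm s + norm c * norm s"
        by (simp add: algebra_simps)
      moreover have "0 \<le> norm c * norm s" by simp
      ultimately show ?thesis using norm_triangle_ineq[of s c] by linarith
    qed
    hence "A * (1 + norm (s + c)) ^ m \<le> A * ((1 + norm c) * (1 + norm s)) ^ m"
      using A(1) by (intro mult_left_mono power_mono) auto
    thus "norm (g (s + c)) \<le> (A * (1 + norm c) ^ m) * (1 + norm s) ^ m"
      using A(2)[OF assms(2)[OF s]] by (simp add: power_mult_distrib mult_ac)
  qed
qed

lemmas poly_bounded_on_intros = poly_bounded_on_const poly_bounded_on_id poly_bounded_on_mult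
  poly_bounded_on_add poly_bounded_on_diff poly_bounded_on_sum poly_bounded_on_prod

lemma poly_bounded_on_ffac: "poly_bounded_on S (ffac i)"
  unfolding ffac_def[abs_def] by (intro poly_bounded_on_intros)

section \<open>Polynomial growth of (s - 1) zeta(s) in half-planes\<close>

text \<open>Asking for 3/2 makes the majorant series independent of \<open>s\<close>, and only the
  polynomial \<open>ffac\<close> varies.\<close>

lemma norm_suminf_taylor_rem_le:
  assumes "Re s + real m \<ge> 3 / 2"
  shows "norm (\<Sum>n. taylor_rem m s n) \<le> norm (ffac (Suc m) s) * (\<Sum>n. real (Suc n) powr (- 3 / 2))"
proof -
  have "summable (\<lambda>n. real n powr (- 3 / 2))" by (subst summable_real_powr_iff) auto
  hence sm: "summable (\<lambda>n. real (Suc n) powr (- 3 / 2))" by (subst summable_Suc_iff)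
  have sm': "summable (taylor_rem m s)" using taylor_rem_suminf(2)[of s m] assms by simp
  show ?thesis
  proof (rule norm_sums_le[OF summable_sums[OF sm'] sums_mult[OF summable_sums[OF sm]]])
    fix n
    have "norm (taylor_rem m s n) \<le> norm (ffac (Suc m) s) * real (Suc n) powr (- Re s - real m)"
      by (rule taylor_rem_bound) (use assms in auto)
    also have "\<dots> \<le> norm (ffac (Suc m) s) * real (Suc n) powr (- 3 / 2)"
      using assms by (intro mult_left_mono powr_mono) auto
    finally show "norm (taylor_rem m s n) \<le> norm (ffac (Suc m) s) * real (Suc n) powr (- 3 / 2)" .
  qed
qed

context
  fixes F :: "complex \<Rightarrow> complex"
  assumes F: "F holomorphic_on UNIV" "\<And>s. Re s > 1 \<Longrightarrow> F s = (s - 1) * dser s"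
begin

text \<open>For Re s > 1 this is \<open>sum_taylor_rem\<close>, where one factor of
  \<open>ffac (Suc j)\<close> turns \<open>dser\<close> into \<open>F\<close>; the identity theorem
  extends it. The term \<open>j = 0\<close> is \<open>F s\<close>, so \<open>F s\<close> is
  expressed by values of \<open>F\<close> further right.\<close>

lemma suminf_taylor_rem_eq:
  assumes s: "Re s > 1 - real m"
  shows "(\<Sum>n. taylor_rem m s n) = 1 - (\<Sum>j<m. ffac j s / fact (Suc j) * F (s + of_nat j))"
proof (rule analytic_continuation_open[where s = "{s. Re s > 1}" and s' = "{s. Re s > 1 - real m}"
      and f = "\<lambda>s. \<Sum>n. taylor_rem m s n"])
  show "(\<lambda>s. 1 - (\<Sum>j<m. ffac j s / fact (Suc j) * F (s + of_nat j))) holomorphic_on {s. Re s > 1 - real m}"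
    by (intro holomorphic_intros holomorphic_on_compose_gen[OF _ F(1), unfolded o_def])
       (auto simp: ffac_def simp del: fact_Suc intro!: holomorphic_intros)
  show "(\<Sum>n. taylor_rem m z n) = 1 - (\<Sum>j<m. ffac j z / fact (Suc j) * F (z + of_nat j))"
    if "z \<in> {s. Re s > 1}" for z
  proof -
    have "(\<Sum>i=1..m. ffac i z / fact i * dser (z + of_nat i - 1))
        = (\<Sum>j<m. ffac (Suc j) z / fact (Suc j) * dser (z + of_nat j))"
      by (rule sum.reindex_bij_witness[of _ Suc "\<lambda>i. i - 1"]) (auto simp: add_diff_eq simp del: fact_Suc)
    also have "\<dots> = (\<Sum>j<m. - (ffac j z / fact (Suc j) * F (z + of_nat j)))"
      using that by (intro sum.cong refl) (simp add: F(2) ffac_Suc del: fact_Suc)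
    finally show ?thesis using that by (subst sum_taylor_rem) (auto simp: sum_negf)
  qed
  show "connected {s. Re s > 1 - real m}" by (intro convex_connected convex_halfspace_Re_gt)
  have "2 \<in> {s. Re s > 1}" by simp
  thus "{s. Re s > 1} \<noteq> {}" by blast
qed (use s in \<open>auto intro: taylor_rem_suminf(1) open_halfspace_Re_gt\<close>)

text \<open>Induction in steps of width 1: the Dirichlet series starts it at Re s >= 3/2, and the
  preceding identity, solved for \<open>F s\<close>, involves only \<open>F (s + j)\<close> with
  \<open>j >= 1\<close>, which lies in the half-plane already treated.\<close>

lemma poly_bounded_on_halfplane: "poly_bounded_on {s. Re s \<ge> a} F"
proof -
  have "poly_bounded_on {s. Re s \<ge> 3 / 2 - real m} F" for m
  proof (induction m)
    case 0
    have "poly_bounded_on {s. Re s \<ge> 3 / 2} (\<lambda>s. (s - 1) * of_real (\<Sum>n. real (Suc n) powr (- 3 / 2)))"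
      by (intro poly_bounded_on_intros)
    moreover have "norm (F s) \<le> norm ((s - 1) * of_real (\<Sum>n. real (Suc n) powr (- 3 / 2)))"
      if s: "Re s \<ge> 3 / 2" for s
    proof -
      have "summable (\<lambda>n. real n powr (- 3 / 2))" by (subst summable_real_powr_iff) auto
      hence sm: "summable (\<lambda>n. real (Suc n) powr (- 3 / 2))" by (subst summable_Suc_iff)
      have "norm (dser s) \<le> (\<Sum>n. real (Suc n) powr (- 3 / 2))"
      proof (rule norm_sums_le[OF dser_sums summable_sums[OF sm]])
        show "norm (1 / of_nat (Suc n) powr s :: complex) \<le> real (Suc n) powr (- 3 / 2)" for n
          unfolding norm_one_div_powr using s by (intro powr_mono) auto
      qed (use s in auto)
      thus ?thesis using s by (simp add: F(2) norm_mult mult_left_mono)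
    qed
    ultimately show ?case by (auto intro: poly_bounded_on_le)
  next
    case (Suc m)
    let ?S = "{s. Re s \<ge> 3 / 2 - real (Suc m)}"
    define T where "T = (\<lambda>s. \<Sum>n. taylor_rem (Suc m) s n)"
    have "poly_bounded_on ?S (\<lambda>s. ffac (Suc (Suc m)) s * of_real (\<Sum>n. real (Suc n) powr (- 3 / 2)))"
      by (intro poly_bounded_on_intros poly_bounded_on_ffac)
    moreover have "norm (T s) \<le> norm (ffac (Suc (Suc m)) s * of_real (\<Sum>n. real (Suc n) powr (- 3 / 2)))"
      if "s \<in> ?S" for s
      unfolding T_def norm_mult norm_of_real
      by (rule order_trans[OF norm_suminf_taylor_rem_le]) (use that in \<open>auto intro!: mult_left_mono\<close>)
    ultimately have T: "poly_bounded_on ?S T" by (rule poly_bounded_on_le)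
    have "poly_bounded_on ?S (\<lambda>s. 1 - T s - (\<Sum>j=1..m. ffac j s * (1 / fact (Suc j)) * F (s + of_nat j)))"
      by (intro poly_bounded_on_intros T poly_bounded_on_ffac poly_bounded_on_shift[OF Suc]) auto
    moreover have "F s = 1 - T s - (\<Sum>j=1..m. ffac j s * (1 / fact (Suc j)) * F (s + of_nat j))" if "s \<in> ?S" for s
    proof -
      have "T s = 1 - (\<Sum>j<Suc m. ffac j s / fact (Suc j) * F (s + of_nat j))"
        unfolding T_def by (rule suminf_taylor_rem_eq) (use that in auto)
      also have "(\<Sum>j<Suc m. ffac j s / fact (Suc j) * F (s + of_nat j))
         = F s + (\<Sum>j=1..m. ffac j s * (1 / fact (Suc j)) * F (s + of_nat j))"
      proof -
        have "{..<Suc m} = insert 0 {1..m}" by auto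
        thus ?thesis by (simp add: ffac_def del: fact_Suc)
      qed
      finally show ?thesis by simp
    qed
    ultimately show ?case by (auto intro: poly_bounded_on_le)
  qed
  note * = this
  obtain m where m: "3 / 2 - a < real m" by (rule reals_Archimedean2[THEN exE])
  show ?thesis
    by (rule poly_bounded_on_subset[OF *[of m]]) (use m in auto)
qed

end

section \<open>Holomorphy and growth of 1/zeta in zero-free half-planes\<close>

lemma zeta_factorization:
  obtains F where "F holomorphic_on UNIV" "\<And>s. Re s > 1 \<Longrightarrow> F s = (s - 1) * dser s" "F 1 = 1"
    "\<And>s. zeta s = F s / (s - 1)"
proof -
  obtain F where F: "F holomorphic_on UNIV" "\<And>s. Re s > 1 \<Longrightarrow> F s = (s - 1) * dser s" "F 1 = 1"
    using continuation_entire by blast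
  show ?thesis
    by (rule that[OF F]) (simp_all add: zeta_eq_quotient(1)[OF F])
qed

text \<open>The reciprocal is (s - 1)/F(s). At the pole, \<open>zeta 1 = 0\<close> and division by
  zero give the value 0, which is also the value of that quotient, so \<open>s = 1\<close> need not
  be removed.\<close>

lemma holomorphic_on_inverse_zeta:
  assumes zf: "\<And>s. Re s > \<sigma> \<Longrightarrow> s \<noteq> 1 \<Longrightarrow> zeta s \<noteq> 0"
  shows "(\<lambda>s. 1 / zeta s) holomorphic_on {s. Re s > \<sigma>}"
proof -
  obtain F where F: "F holomorphic_on UNIV" "\<And>s. Re s > 1 \<Longrightarrow> F s = (s - 1) * dser s" "F 1 = 1"
    "\<And>s. zeta s = F s / (s - 1)"
    using zeta_factorization by blast
  have "F s \<noteq> 0" if "Re s > \<sigma>" for s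
    using zf[OF that] F(3) F(4)[of s] by (cases "s = 1") auto
  hence "(\<lambda>s. (s - 1) / F s) holomorphic_on {s. Re s > \<sigma>}"
    by (intro holomorphic_intros holomorphic_on_subset[OF F(1)]) auto
  thus ?thesis by (simp add: F(4))
qed

text \<open>The lower bound for nonvanishing functions is applied to the entire \<open>F\<close>,
  which has no pole to avoid, on discs centred on a fixed vertical line. The radii do not depend on
  \<open>s\<close>, so neither does the exponent \<open>N\<close>.\<close>

lemma poly_bounded_on_inverse_zeta:
  assumes zf: "\<And>s. Re s > \<sigma>\<^sub>0 \<Longrightarrow> s \<noteq> 1 \<Longrightarrow> zeta s \<noteq> 0" and \<sigma>: "\<sigma>\<^sub>0 < \<sigma>\<^sub>1"
  shows "poly_bounded_on {s. Re s \<ge> \<sigma>\<^sub>1} (\<lambda>s. 1 / zeta s)"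
proof -
  obtain F where F: "F holomorphic_on UNIV" "\<And>s. Re s > 1 \<Longrightarrow> F s = (s - 1) * dser s" "F 1 = 1"
    "\<And>s. zeta s = F s / (s - 1)"
    using zeta_factorization by blast
  have F_nz: "F s \<noteq> 0" if "Re s > \<sigma>\<^sub>0" for s
    using zf[OF that] F(3) F(4)[of s] by (cases "s = 1") auto
  obtain \<eta> \<kappa> where \<eta>: "0 < \<eta>" "\<eta> < 1" and \<kappa>: "0 < \<kappa>" "\<And>s. Re s \<ge> 2 - \<eta> \<Longrightarrow> norm (zeta s) \<ge> \<kappa>"
    by (rule zeta_lower_bound) blast
  have F_right: "norm (F s) \<ge> \<kappa>" if "Re s \<ge> 3" for s
  proof -
    have "s \<noteq> 1" using that by auto
    hence "F s = (s - 1) * zeta s" by (simp add: F(4))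
    moreover have "1 * \<kappa> \<le> norm (s - 1) * norm (zeta s)"
      using that \<eta> abs_Re_le_cmod[of "s - 1"] \<kappa>(1) by (intro mult_mono \<kappa>(2)) auto
    ultimately show ?thesis by (simp add: norm_mult)
  qed
  \<comment> \<open>\<open>c >= 3\<close> gives |F| >= \<kappa> at the centres. The inner radius
    \<open>r\<close> reaches the line Re = \<open>\<sigma>\<^sub>1\<close>; the outer one stops
    halfway to \<open>\<sigma>\<^sub>0\<close>, still inside the zero-free half-plane.\<close>
  define c where "c = max 3 (\<sigma>\<^sub>1 + 1)"
  define r where "r = c - \<sigma>\<^sub>1"
  define R where "R = c - (\<sigma>\<^sub>0 + \<sigma>\<^sub>1) / 2"
  have r: "0 < r" "r < R" using \<sigma> by (auto simp: r_def R_def c_def)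
  obtain A m where A: "A > 0" "\<And>s. Re s \<ge> c - R \<Longrightarrow> norm (F s) \<le> A * (1 + norm s) ^ m"
    by (rule poly_bounded_onE[OF poly_bounded_on_halfplane[OF F(1,2), of "c - R"]]) auto
  obtain N where N: "2 * r / (R - r) \<le> real N" using real_arch_simple by blast
  \<comment> \<open>\<open>A + 1\<close> in place of \<open>A\<close> yields the strict bound by
    \<open>M\<close> that is required on the disc.\<close>
  define D where "D = (A + 1) * (1 + r + R) ^ m"
  have D: "D > 0" unfolding D_def using A r by (intro mult_pos_pos zero_less_power) auto
  \<comment> \<open>The summand 1 next to the power lets the same bound cover Re s >= c, where
    1/\<kappa> suffices.\<close>
  have main: "norm (1 / F s) \<le> (1 / \<kappa> * ((D / \<kappa>) ^ N + 1)) * (1 + norm s) ^ (m * N)" if s: "Re s \<ge> \<sigma>\<^sub>1" for s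
  proof (cases "Re s \<ge> c")
    case True
    hence "norm (1 / F s) \<le> 1 / \<kappa>"
      using F_right[of s] \<kappa>(1) by (simp add: norm_divide c_def frac_le)
    also have "\<dots> \<le> 1 / \<kappa> * (((D / \<kappa>) ^ N + 1) * (1 + norm s) ^ (m * N))"
    proof -
      have "1 * 1 \<le> ((D / \<kappa>) ^ N + 1) * (1 + norm s) ^ (m * N)"
        using D \<kappa>(1) by (intro mult_mono one_le_power) auto
      thus ?thesis using \<kappa>(1) mult_left_mono[of 1 _ "1 / \<kappa>"] by auto
    qed
    finally show ?thesis by (simp add: mult.assoc)
  next
    case False
    define s\<^sub>0 where "s\<^sub>0 = Complex c (Im s)"
    define M where "M = D * (1 + norm s) ^ m"
    have M0: "M > 0" unfolding M_def using D by (intro mult_pos_pos zero_less_power) (auto intro: add_pos_nonneg)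
    have "s\<^sub>0 - s = of_real (c - Re s)" by (simp add: s\<^sub>0_def complex_eq_iff)
    hence dist: "norm (s\<^sub>0 - s) = c - Re s" using False by (simp only: norm_of_real)
    have Fs0: "\<kappa> \<le> norm (F s\<^sub>0)" by (rule F_right) (simp add: s\<^sub>0_def c_def)
    have *: "norm (F s\<^sub>0) * (norm (F s\<^sub>0) / M) ^ N \<le> norm (F s)"
    proof (rule holomorphic_nonzero_lower_bound[where F = F and c = s\<^sub>0, OF _ r _ _ N])
      show "F holomorphic_on ball s\<^sub>0 R" by (rule holomorphic_on_subset[OF F(1)]) auto
      show "s \<in> cball s\<^sub>0 r" using s dist by (simp add: dist_norm r_def)
      fix z assume z: "z \<in> ball s\<^sub>0 R"
      hence zs: "norm (s\<^sub>0 - z) < R" by (simp add: dist_norm)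
      have Rez: "Re z > c - R"
        using abs_Re_le_cmod[of "s\<^sub>0 - z"] zs by (simp add: s\<^sub>0_def)
      thus "F z \<noteq> 0" using \<sigma> by (intro F_nz) (simp add: R_def field_simps)
      have "norm z = norm (s + (s\<^sub>0 - s) - (s\<^sub>0 - z))" by simp
      also have "\<dots> \<le> norm s + norm (s\<^sub>0 - s) + norm (s\<^sub>0 - z)"
        by (meson add_right_mono norm_triangle_ineq norm_triangle_ineq4 order_trans)
      finally have "1 + norm z \<le> 1 + norm s + r + R" using dist s zs by (simp add: r_def)
      also have "\<dots> \<le> (1 + r + R) * (1 + norm s)"
      proof -
        have "(1 + r + R) * (1 + norm s) = 1 + norm s + r + R + (r + R) * norm s" by (simp add: algebra_simps)
        thus ?thesis using r by simp
      qed
      finally have "A * (1 + norm z) ^ m \<le> A * ((1 + r + R) * (1 + norm s)) ^ m"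
        using A by (intro mult_left_mono power_mono) auto
      also have "\<dots> < (A + 1) * ((1 + r + R) * (1 + norm s)) ^ m"
        using r by (intro mult_strict_right_mono zero_less_power mult_pos_pos) (auto intro: add_pos_nonneg)
      finally show "norm (F z) < M"
        using A(2)[of z] Rez by (simp add: M_def D_def power_mult_distrib mult_ac)
    qed
    have "\<kappa> * (\<kappa> / M) ^ N \<le> norm (F s\<^sub>0) * (norm (F s\<^sub>0) / M) ^ N"
      using Fs0 \<kappa>(1) M0 by (intro mult_mono power_mono divide_right_mono) auto
    also note *
    finally have "norm (1 / F s) \<le> 1 / (\<kappa> * (\<kappa> / M) ^ N)"
      using \<kappa>(1) M0 by (simp add: norm_divide frac_le)
    also have "\<dots> = 1 / \<kappa> * (D / \<kappa>) ^ N * (1 + norm s) ^ (m * N)"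
      using \<kappa>(1) M0 by (simp add: M_def power_divide power_mult_distrib power_mult)
    also have "\<dots> \<le> (1 / \<kappa> * ((D / \<kappa>) ^ N + 1)) * (1 + norm s) ^ (m * N)"
      using \<kappa>(1) D by (intro mult_right_mono mult_left_mono) auto
    finally show ?thesis .
  qed
  have "poly_bounded_on {s. Re s \<ge> \<sigma>\<^sub>1} (\<lambda>s. 1 / F s)"
    by (rule poly_bounded_onI) (use main in blast)
  hence "poly_bounded_on {s. Re s \<ge> \<sigma>\<^sub>1} (\<lambda>s. (s - 1) * (1 / F s))"
    by (intro poly_bounded_on_intros)
  thus ?thesis by (simp add: F(4))
qed

section \<open>The criterion\<close>

text \<open>Under s = 2z + 2 the half-plane Re s > 2(1 - a) becomes Re z > -a, and the pole s = 1
  becomes z = -1/2.\<close>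

definition inv_zeta :: "complex \<Rightarrow> complex" where
  "inv_zeta z = 1 / zeta (2 * z + 2)"

lemma newton_coeff_inv_zeta: "newton_coeff inv_zeta k = zeta_coeff k"
  by (simp add: newton_coeff_def inv_zeta_def zeta_coeff_def atLeast0AtMost add_ac)

lemma holomorphic_on_inv_zeta:
  assumes "\<And>s. Re s > 2 * (1 - a) \<Longrightarrow> s \<noteq> 1 \<Longrightarrow> zeta s \<noteq> 0"
  shows "inv_zeta holomorphic_on {z. Re z > - a}"
  unfolding inv_zeta_def
  by (rule holomorphic_on_compose_gen[of "\<lambda>z. 2 * z + 2", unfolded o_def,
        OF _ holomorphic_on_inverse_zeta[OF assms]])
     (auto intro!: holomorphic_intros)

lemma zeta_coeff_bound:
  assumes zf: "\<And>s. Re s > 2 * (1 - a) \<Longrightarrow> s \<noteq> 1 \<Longrightarrow> zeta s \<noteq> 0" and b: "0 < b" "b < a"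
  shows "\<exists>C>0. \<forall>k\<ge>1. norm (zeta_coeff k) \<le> C * real k powr (- b)"
proof -
  have "2 * (1 - a) < 2 * (1 - b)" using b by simp
  from poly_bounded_onE[OF poly_bounded_on_inverse_zeta[OF zf this]]
  obtain A m where A: "A > 0" "\<And>s. Re s \<ge> 2 * (1 - b) \<Longrightarrow> norm (1 / zeta s) \<le> A * (1 + norm s) ^ m"
    by (metis mem_Collect_eq)
  have "norm (inv_zeta w) \<le> A * 3 ^ m * (1 + norm w) ^ m" if "Re w \<ge> - b" for w
  proof -
    have "norm (2 * w + 2) \<le> 2 * norm w + 2"
      using norm_triangle_ineq[of "2 * w" 2] by (simp add: norm_mult)
    hence "1 + norm (2 * w + 2) \<le> 1 + (2 * norm w + 2)" by simp
    also have "\<dots> \<le> 3 * (1 + norm w)" by simp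
    finally have "1 + norm (2 * w + 2) \<le> 3 * (1 + norm w)" .
    hence "A * (1 + norm (2 * w + 2)) ^ m \<le> A * (3 * (1 + norm w)) ^ m"
      using A by (intro mult_left_mono power_mono) auto
    moreover have "norm (inv_zeta w) \<le> A * (1 + norm (2 * w + 2)) ^ m"
      unfolding inv_zeta_def using that by (intro A) simp
    ultimately show ?thesis by (simp only: power_mult_distrib mult.assoc)
  qed
  moreover have "inv_zeta holomorphic_on {z. Re z > - a}"
    by (rule holomorphic_on_inv_zeta) (rule zf)
  ultimately have "\<exists>C>0. \<forall>k\<ge>1. norm (newton_coeff inv_zeta k) \<le> C * real k powr (- b)"
    using b by (intro newton_coeff_bound)
  thus ?thesis by (simp only: newton_coeff_inv_zeta)
qed

text \<open>Unconditional: the lower bound for zeta makes \<open>inv_zeta\<close> holomorphic on Re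
  z > -\<eta>/2 and bounded on Re z >= -\<eta>/4.\<close>

lemma zeta_coeff_sums:
  assumes x: "0 < x" "x < 1"
  shows "(\<lambda>k. zeta_coeff k * pochhammer (- of_real x) k / fact k) sums inv_zeta (of_real x)"
proof -
  obtain \<eta> \<kappa> where \<eta>: "0 < \<eta>" "\<eta> < 1" and \<kappa>: "0 < \<kappa>" "\<And>s. Re s \<ge> 2 - \<eta> \<Longrightarrow> norm (zeta s) \<ge> \<kappa>"
    by (rule zeta_lower_bound) blast
  have zf: "zeta s \<noteq> 0" if "Re s > 2 * (1 - \<eta> / 2)" for s
    using \<kappa>(1) \<kappa>(2)[of s] that by (auto simp: algebra_simps)
  have bd: "norm (inv_zeta w) \<le> 1 / \<kappa>" if "Re w \<ge> - (\<eta> / 4)" for w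
    using \<kappa>(1) \<kappa>(2)[of "2 * w + 2"] that \<eta> by (simp add: inv_zeta_def norm_divide frac_le)
  have "(\<lambda>k. newton_coeff inv_zeta k * pochhammer (- of_real x) k / fact k) sums inv_zeta (of_real x)"
    by (rule newton_series_sums[of _ "\<eta> / 2" "\<eta> / 4", OF holomorphic_on_inv_zeta _ _ bd x]) (use zf \<eta> in auto)
  thus ?thesis by (simp only: newton_coeff_inv_zeta)
qed

lemma islimpt_of_real_image_interval: "(1 / 2 :: complex) islimpt of_real ` {0<..<1::real}"
proof (unfold islimpt_approachable, intro allI impI)
  fix e :: real assume e: "e > 0"
  define d where "d = min (e / 2) (1 / 4)"
  have d: "0 < d" "d < e" "1 / 2 + d < 1" using e by (auto simp: d_def min_def)
  show "\<exists>x'\<in>complex_of_real ` {0<..<1}. x' \<noteq> 1 / 2 \<and> dist x' (1 / 2) < e"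
  proof (intro bexI conjI)
    show "complex_of_real (1 / 2 + d) \<in> complex_of_real ` {0<..<1}"
      using d by (intro imageI) auto
  qed (use d in \<open>auto simp: dist_norm\<close>)
qed

text \<open>The Newton series continues the reciprocal of zeta to Re z > -\<alpha>. At a zero of
  zeta other than 1, the continued identity F(s) G(w) = s - 1 would have left side 0 and nonzero
  right side.\<close>

lemma zeta_nonzero_of_coeff_bound:
  assumes a: "\<alpha> > 0"
    and c: "\<And>\<epsilon>. \<epsilon> > 0 \<Longrightarrow> \<exists>C. \<forall>k\<ge>1. norm (zeta_coeff k) \<le> C * real k powr (- \<alpha> + \<epsilon>)"
    and s: "Re s > 2 * (1 - \<alpha>)" "s \<noteq> 1"
  shows "zeta s \<noteq> 0"
proof
  assume z0: "zeta s = 0"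
  obtain F where F: "F holomorphic_on UNIV" "\<And>s. Re s > 1 \<Longrightarrow> F s = (s - 1) * dser s" "F 1 = 1"
    "\<And>s. zeta s = F s / (s - 1)"
    using zeta_factorization by blast
  define G where "G = (\<lambda>z. \<Sum>k. zeta_coeff k * (pochhammer (- z) k / fact k))"
  define w where "w = s / 2 - 1"
  \<comment> \<open>The identity \<open>zeta (2 * z + 2) * G z = 1\<close>, cleared of the pole at \<open>z = -1/2\<close>\<close>
  have "F (2 * w + 2) * G w - (2 * w + 1) = 0"
  proof (rule analytic_continuation[where f = "\<lambda>z. F (2 * z + 2) * G z - (2 * z + 1)"
        and S = "{z. Re z > - \<alpha>}" and U = "complex_of_real ` {0<..<1}"])
    show "(\<lambda>z. F (2 * z + 2) * G z - (2 * z + 1)) holomorphic_on {z. Re z > - \<alpha>}"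
      unfolding G_def
      by (intro holomorphic_intros newton_series_holomorphic c
            holomorphic_on_compose_gen[OF _ F(1), unfolded o_def]) auto
    show "connected {z. Re z > - \<alpha>}" by (intro convex_connected convex_halfspace_Re_gt)
    show "F (2 * z + 2) * G z - (2 * z + 1) = 0" if "z \<in> complex_of_real ` {0<..<1}" for z
    proof -
      obtain x where x: "z = of_real x" "0 < x" "x < 1" using \<open>z \<in> _\<close> by auto
      have "G z = inv_zeta z"
        using zeta_coeff_sums[OF x(2,3)] by (simp add: G_def x(1) sums_iff)
      moreover have "zeta (2 * z + 2) \<noteq> 0"
      proof -
        obtain \<eta> \<kappa> where \<eta>: "0 < \<eta>" "\<eta> < 1" and \<kappa>: "0 < \<kappa>" "\<And>s. Re s \<ge> 2 - \<eta> \<Longrightarrow> norm (zeta s) \<ge> \<kappa>"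
          by (rule zeta_lower_bound) blast
        show ?thesis using \<kappa>(2)[of "2 * z + 2"] \<kappa>(1) \<eta> x by auto
      qed
      hence "F (2 * z + 2) \<noteq> 0" by (auto simp: F(4))
      ultimately show ?thesis by (simp add: inv_zeta_def F(4))
    qed
    show "(1 / 2 :: complex) \<in> {z. Re z > - \<alpha>}" using a by simp
  qed (use a s in \<open>auto simp: w_def open_halfspace_Re_gt islimpt_of_real_image_interval\<close>)
  moreover have "2 * w + 2 = s" "2 * w + 1 = s - 1" by (simp_all add: w_def)
  ultimately show False using z0 s(2) F(4)[of s] by simp
qed

theorem theorem1p2:
  fixes \<alpha> :: real
  shows "(\<forall>s::complex. Re s > 2 * (1 - \<alpha>) \<and> s \<noteq> 1 \<longrightarrow> zeta s \<noteq> 0) \<longleftrightarrow>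
         (\<forall>\<epsilon>>0. \<exists>C>0. \<forall>k\<ge>1. norm (zeta_coeff k) \<le> C * real k powr (- \<alpha> + \<epsilon>))"
proof -
  obtain \<eta> \<kappa> where \<eta>: "0 < \<eta>" "\<eta> < 1" and \<kappa>: "0 < \<kappa>" "\<And>s. Re s \<ge> 2 - \<eta> \<Longrightarrow> norm (zeta s) \<ge> \<kappa>"
    by (rule zeta_lower_bound) blast
  have zf: "zeta s \<noteq> 0" if "Re s \<ge> 2 - \<eta>" for s
    using \<kappa>(1) \<kappa>(2)[OF that] by auto
  show ?thesis
  proof (intro iffI allI impI)
    fix \<epsilon> :: real
    assume L: "\<forall>s::complex. Re s > 2 * (1 - \<alpha>) \<and> s \<noteq> 1 \<longrightarrow> zeta s \<noteq> 0" and \<epsilon>: "\<epsilon> > 0"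
    \<comment> \<open>The coefficient bound is available for positive exponents \<open>b\<close>
      only, so a positive \<open>b >= \<alpha> - \<epsilon>\<close> is sought.\<close>
    have "\<exists>b. b \<ge> \<alpha> - \<epsilon> \<and> (\<exists>C>0. \<forall>k\<ge>1. norm (zeta_coeff k) \<le> C * real k powr (- b))"
    proof (cases "\<alpha> > 0")
      case True
      \<comment> \<open>The maximum with \<alpha>/2 keeps the exponent positive and below \<alpha>
        even for large \<epsilon>.\<close>
      let ?b = "max (\<alpha> - \<epsilon>) (\<alpha> / 2)"
      have "\<exists>C>0. \<forall>k\<ge>1. norm (zeta_coeff k) \<le> C * real k powr (- ?b)"
        by (rule zeta_coeff_bound[of \<alpha>]) (use L True \<epsilon> in auto)
      thus ?thesis by (intro exI[of _ ?b]) auto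
    next
      case False
      \<comment> \<open>For \<alpha> <= 0 the unconditional decay from the strip to the left of Re s
        = 2 is already more than enough.\<close>
      have "\<exists>C>0. \<forall>k\<ge>1. norm (zeta_coeff k) \<le> C * real k powr (- (\<eta> / 4))"
        by (rule zeta_coeff_bound[of "\<eta> / 2"]) (use zf \<eta> in auto)
      thus ?thesis using False \<epsilon> \<eta> by (intro exI[of _ "\<eta> / 4"]) auto
    qed
    then obtain b C where b: "b \<ge> \<alpha> - \<epsilon>" and C: "C > 0" "\<And>k. k \<ge> 1 \<Longrightarrow> norm (zeta_coeff k) \<le> C * real k powr (- b)"
      by blast
    show "\<exists>C>0. \<forall>k\<ge>1. norm (zeta_coeff k) \<le> C * real k powr (- \<alpha> + \<epsilon>)"
    proof (intro exI[of _ C] conjI allI impI)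
      fix k :: nat assume k: "k \<ge> 1"
      have "C * real k powr (- b) \<le> C * real k powr (- \<alpha> + \<epsilon>)"
        using C(1) b k by (intro mult_left_mono powr_mono) auto
      thus "norm (zeta_coeff k) \<le> C * real k powr (- \<alpha> + \<epsilon>)" using C(2)[OF k] by linarith
    qed (use C in auto)
  next
    fix s :: complex
    assume R: "\<forall>\<epsilon>>0. \<exists>C>0. \<forall>k\<ge>1. norm (zeta_coeff k) \<le> C * real k powr (- \<alpha> + \<epsilon>)"
      and s: "Re s > 2 * (1 - \<alpha>) \<and> s \<noteq> 1"
    show "zeta s \<noteq> 0"
    proof (cases "\<alpha> > 0")
      case True
      show ?thesis by (rule zeta_nonzero_of_coeff_bound[OF True]) (use R s in blast)+
    next
      case False
      \<comment> \<open>Here \<alpha> <= 0, so Re s > 2 and zeta is bounded below.\<close>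
      thus ?thesis using s \<eta> by (intro zf) (auto simp: algebra_simps)
    qed
  qed
qed

end
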